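(* For $1\leq p<\infty$ and $a<p-1$, $$B_{p,a}^p=\begin{cases} \frac{1-a}{-a} & \text{if } p=1,\\ C_{p,a}^p & \text{if } 1<p<2,\ \ p-2<a<p-1,\\ k_{p,a}(0,\beta_1) & \text{if } 1<p<2,\ \ a\leq p-2,\\ \max\{A_{p,a}^p\mathbf{1}_{\{-1<a\}},1\} & \text{if } p\geq 2,\ \ a<p-1. \end{cases}$$ Here, for $1<p<2$ and $a\leq p-2$, $\beta_1=\beta_1(p,a)$ is the unique solution of the equation $$(p-1-a)|1-\beta_1|^{p-2}(\beta_1-1)-(p-1)\beta_1+p-1-a=0$$ in the interval $(1,\infty)$ (existence and uniqueness being part of the assertion).
   Context: For a locally integrable $f\colon[0,\infty)\to\mathbb{R}$ the Hardy operator is $Hf(t)=\frac1t\int_0^t f(s)\,ds$, $t>0$. For $1\le p<\infty$ and $a<p-1$, $C_{p,a}$ (resp. $B_{p,a}$, resp. $A_{p,a}$) denotes the smallest constant $K$ such that $$\int_0^\infty|Hf(t)-f(t)|^p t^a\,dt\le K^p\int_0^\infty|f(t)|^pt^a\,dt$$ for all measurable (resp. all positive, resp. all positive and decreasing) real functions $f$ on the half-line for which the right-hand side is finite; $A_{p,a}$ is considered only for $-1<a<p-1$. Here "positive" means $f\ge0$ and "decreasing" means non-increasing on $(0,\infty)$ (the value at $t=0$ is irrelevant). $\max\{A_{p,a}^p\mathbf 1_{\{-1<a\}},1\}$ means $\max\{A_{p,a}^p,1\}$ if $a>-1$ and $1$ if $a\le -1$. For $\alpha<\frac{p-1-a}{p}<\beta$,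 $$k_{p,a}(\alpha,\beta)=\frac{(\beta-\frac{p-1-a}{p})|\alpha-1|^p+(\frac{p-1-a}{p}-\alpha)|\beta-1|^p}{(\beta-\frac{p-1-a}{p})|\alpha|^p+(\frac{p-1-a}{p}-\alpha)|\beta|^p}.$$ (In the third case one has $\beta_1>(p-1-a)/p$, so that $k_{p,a}(0,\beta_1)$ is given by this formula.) *)

theory Defs
  imports "HOL-Analysis.Analysis"
begin

definition hardy_op :: "(real \<Rightarrow> real) \<Rightarrow> real \<Rightarrow> real" where
  "hardy_op f t = (1 / t) * (LINT s:{0<..t}|lebesgue. f s)"

definition weighted_pow :: "real \<Rightarrow> real \<Rightarrow> (real \<Rightarrow> real) \<Rightarrow> ennreal" where
  "weighted_pow p a g =
     (\<integral>\<^sup>+ t. ennreal (\<bar>g t\<bar> powr p * t powr a) \<partial>(lebesgue_on {0<..}))"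

definition half_line_funs :: "(real \<Rightarrow> real) set" where
  "half_line_funs = borel_measurable (lebesgue_on {0<..})"

definition positive_funs :: "(real \<Rightarrow> real) set" where
  "positive_funs = {f \<in> half_line_funs. \<forall>t>0. 0 \<le> f t}"

definition positive_decreasing_funs :: "(real \<Rightarrow> real) set" where
  "positive_decreasing_funs = {f \<in> positive_funs. antimono_on {0<..} f}"

text \<open>For \<open>1 \<le> p\<close> and \<open>a < p - 1\<close>, Hoelder's inequality shows that finiteness of the
  right-hand side makes \<open>f\<close> integrable on every \<open>(0,t]\<close>, so \<open>hardy_op f\<close> is then a genuine
  integral mean and local integrability need not be assumed separately.\<close>

definition hardy_bound :: "(real \<Rightarrow> real) set \<Rightarrow> real \<Rightarrow> real \<Rightarrow> real \<Rightarrow> bool" where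
  "hardy_bound F p a K \<longleftrightarrow> 0 \<le> K \<and>
     (\<forall>f\<in>F. weighted_pow p a f < \<infinity> \<longrightarrow>
        weighted_pow p a (\<lambda>t. hardy_op f t - f t) \<le> ennreal (K powr p) * weighted_pow p a f)"

text \<open>In the range \<open>1 \<le> p\<close>, \<open>a < p - 1\<close> admissible constants exist by the weighted Hardy
  inequality, and they form a closed set, so the least one exists.\<close>

definition C_const :: "real \<Rightarrow> real \<Rightarrow> real" where
  "C_const p a = (LEAST K. hardy_bound half_line_funs p a K)"

definition B_const :: "real \<Rightarrow> real \<Rightarrow> real" where
  "B_const p a = (LEAST K. hardy_bound positive_funs p a K)"

text \<open>Meaningful only for \<open>-1 < a\<close>: otherwise no nonzero positive decreasing function
  has a finite right-hand side.\<close>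

definition A_const :: "real \<Rightarrow> real \<Rightarrow> real" where
  "A_const p a = (LEAST K. hardy_bound positive_decreasing_funs p a K)"

definition k_fun :: "real \<Rightarrow> real \<Rightarrow> real \<Rightarrow> real \<Rightarrow> real" where
  "k_fun p a \<alpha> \<beta> =
     ((\<beta> - (p - 1 - a) / p) * \<bar>\<alpha> - 1\<bar> powr p + ((p - 1 - a) / p - \<alpha>) * \<bar>\<beta> - 1\<bar> powr p) /
     ((\<beta> - (p - 1 - a) / p) * \<bar>\<alpha>\<bar> powr p + ((p - 1 - a) / p - \<alpha>) * \<bar>\<beta>\<bar> powr p)"

definition beta1_eq :: "real \<Rightarrow> real \<Rightarrow> real \<Rightarrow> bool" where
  "beta1_eq p a \<beta> \<longleftrightarrow>
     (p - 1 - a) * \<bar>1 - \<beta>\<bar> powr (p - 2) * (\<beta> - 1) - (p - 1) * \<beta> + p - 1 - a = 0"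

definition beta1 :: "real \<Rightarrow> real \<Rightarrow> real" where
  "beta1 p a = (THE \<beta>. 1 < \<beta> \<and> beta1_eq p a \<beta>)"

end

theory Submission
  imports Defs
begin

text \<open>
  Write \<open>b = (p - 1 - a) / p\<close>, \<open>F\<close> for the primitive of \<open>f\<close> and \<open>g = F / t\<close>.
  If a line through \<open>(b, 0)\<close> with slope \<open>c\<close> lies below \<open>x \<mapsto> M \<bar>x\<bar>\<^sup>p - \<bar>x - 1\<bar>\<^sup>p\<close> on the range
  of \<open>f / g\<close>, then putting \<open>x = f / g\<close> and multiplying by \<open>\<bar>g\<bar>\<^sup>p t\<^sup>a\<close> turns the linear term into
  \<open>c / p\<close> times the derivative of \<open>t powr (a + 1 - p) * \<bar>F\<bar> powr p\<close>, which integrates to \<open>0\<close>; so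
  \<open>M\<close> bounds the \<open>p\<close>-th power of the constant. Conversely, for \<open>\<alpha> < b < \<beta>\<close> the function
  \<open>\<beta> t powr (\<beta> - 1)\<close> on \<open>(0, 1]\<close>, continued by \<open>\<alpha> t powr (\<alpha> - 1)\<close>, has quotient exactly
  \<open>k_fun p a \<alpha> \<beta>\<close>; it is positive if \<open>0 \<le> \<alpha>\<close> and also decreasing if \<open>\<alpha> \<le> \<beta> \<le> 1\<close>. Since \<open>k_fun p a \<alpha> \<beta> \<le> M\<close>
  for all admissible \<open>\<alpha>, \<beta>\<close> is equivalent to the existence of such a line, only calculus
  in one variable remains.
\<close>

section \<open>Measurability and local integrability on the half-line\<close>

lemma id_measurable_lebesgue [measurable]: "(\<lambda>t::real. t) \<in> borel_measurable lebesgue"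
  using id_borel_measurable_lebesgue by (simp add: id_def)

lemma weighted_pow_eq:
  "weighted_pow p a g =
     (\<integral>\<^sup>+ t. ennreal (\<bar>g t\<bar> powr p * t powr a) * indicator {0<..} t \<partial>lebesgue)"
  unfolding weighted_pow_def by (subst nn_integral_restrict_space) auto

lemma half_line_funs_iff:
  "f \<in> half_line_funs \<longleftrightarrow> (\<lambda>t. indicator {0<..} t * f t) \<in> borel_measurable lebesgue"
  unfolding half_line_funs_def by (subst borel_measurable_restrict_space_iff) auto

lemma half_line_funs_truncated_measurable:
  assumes "f \<in> half_line_funs"
  shows "(\<lambda>s. indicator {0<..t} s *\<^sub>R f s) \<in> borel_measurable lebesgue"
proof -
  have [measurable]: "(\<lambda>s. indicator {0<..} s * f s) \<in> borel_measurable lebesgue"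
    using assms by (simp add: half_line_funs_iff)
  have "(\<lambda>s. indicator {..t} s * (indicator {0<..} s * f s)) \<in> borel_measurable lebesgue"
    by measurable
  also have "(\<lambda>s. indicator {..t} s * (indicator {0<..} s * f s)) = (\<lambda>s. indicator {0<..t} s *\<^sub>R f s)"
    by (auto simp: indicator_def)
  finally show ?thesis .
qed

lemma continuous_on_half_line_funs:
  "continuous_on {0<..} f \<Longrightarrow> f \<in> half_line_funs"
  unfolding half_line_funs_def
  by (rule continuous_imp_measurable_on_sets_lebesgue) auto

lemma weighted_integrand_measurable:
  assumes "f \<in> half_line_funs"
  shows "(\<lambda>t. ennreal (\<bar>f t\<bar> powr p * t powr a)) \<in> borel_measurable (lebesgue_on {0<..})"
proof -
  have [measurable]: "f \<in> borel_measurable (lebesgue_on {0<..})"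
    using assms by (simp add: half_line_funs_def)
  have [measurable]: "(\<lambda>t::real. t) \<in> borel_measurable (lebesgue_on {0<..})"
    by (rule continuous_imp_measurable_on_sets_lebesgue) (auto intro: continuous_intros)
  show ?thesis by measurable
qed

text \<open>For \<open>1 < p\<close> the threshold \<open>s powr e\<close> splits the points: below
  it \<open>\<bar>f s\<bar>\<close> is dominated by a power with \<open>- 1 < e\<close>, integrable
  at 0; above it \<open>\<bar>f s\<bar> powr (p - 1) * s powr a\<close> is at least 1, so the
  weighted integrand dominates. For \<open>p = 1\<close> the exponent \<open>a\<close> is negative,
  and the weight is at least \<open>t powr a\<close> on \<open>(0, t]\<close>.\<close>

lemma weighted_pow_finite_imp_set_integrable:
  assumes p: "1 \<le> p" and a: "a < p - 1" and f: "f \<in> half_line_funs"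
    and fin: "weighted_pow p a f < \<infinity>"
  shows "set_integrable lebesgue {0<..t} f"
proof -
  define C where "C = (if p = 1 then t powr (- a) else 1)"
  define e where "e = (if p = 1 then 0 else - a / (p - 1))"
  have "- 1 < e"
    using p a by (auto simp: e_def field_simps)
  let ?w = "\<lambda>s. \<bar>f s\<bar> powr p * s powr a * indicator {0<..} s"
  have bnd: "\<bar>f s\<bar> \<le> C * (\<bar>f s\<bar> powr p * s powr a) + s powr e" if s: "0 < s" "s \<le> t" for s
  proof (cases "p = 1")
    case True
    have "a * ln t \<le> a * ln s"
      using s a True by (intro mult_left_mono_neg) auto
    then have "1 \<le> t powr (- a) * s powr a"
      using s by (simp add: powr_def flip: exp_add)
    then have "\<bar>f s\<bar> * 1 \<le> \<bar>f s\<bar> * (t powr (- a) * s powr a)"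
      by (intro mult_left_mono) auto
    moreover have "0 \<le> s powr 0" by simp
    ultimately show ?thesis
      using True by (simp add: C_def e_def algebra_simps)
  next
    case False
    then have p1: "1 < p" using p by simp
    show ?thesis
    proof (cases "\<bar>f s\<bar> \<le> s powr e")
      case True
      then show ?thesis using False by (simp add: C_def add_increasing)
    next
      case f2: False
      have "(s powr e) powr (p - 1) \<le> \<bar>f s\<bar> powr (p - 1)"
        using f2 p1 by (intro powr_mono2) auto
      moreover have "(s powr e) powr (p - 1) = s powr (- a)"
        using p1 by (simp add: powr_powr e_def)
      ultimately have "1 \<le> \<bar>f s\<bar> powr (p - 1) * s powr a"
        using s by (simp add: powr_minus field_simps)
      then have "\<bar>f s\<bar> * 1 \<le> \<bar>f s\<bar> * (\<bar>f s\<bar> powr (p - 1) * s powr a)"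
        by (intro mult_left_mono) auto
      also have "\<dots> = \<bar>f s\<bar> powr p * s powr a"
        using f2 by (cases "f s = 0") (auto simp: powr_diff)
      finally show ?thesis using False by (simp add: C_def add_increasing2)
    qed
  qed
  have m0: "(\<lambda>s. indicator {0<..} s * f s) \<in> borel_measurable lebesgue"
    using f by (simp add: half_line_funs_iff)
  have mw: "(\<lambda>s. \<bar>indicator {0<..} s * f s\<bar> powr p * s powr a) \<in> borel_measurable lebesgue"
    using m0 by measurable
  have weq: "?w = (\<lambda>s. \<bar>indicator {0<..} s * f s\<bar> powr p * s powr a)"
    by (auto simp: indicator_def)
  have "integrable lebesgue ?w"
    unfolding integrable_iff_bounded
  proof
    show "?w \<in> borel_measurable lebesgue"
      unfolding weq by (rule mw)
    have "(\<integral>\<^sup>+ s. ennreal (norm (?w s)) \<partial>lebesgue) = weighted_pow p a f"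
      unfolding weighted_pow_eq by (intro nn_integral_cong) (auto simp: indicator_def)
    then show "(\<integral>\<^sup>+ s. ennreal (norm (?w s)) \<partial>lebesgue) < \<infinity>" using fin by simp
  qed
  then have i1: "integrable lebesgue (\<lambda>s. C * ?w s)" by simp
  have "set_integrable lebesgue {0..t} (\<lambda>s. s powr e)"
    using integrable_on_powr_from_0[OF \<open>- 1 < e\<close>, of t]
    by (cases "0 \<le> t") (auto intro: nonnegative_absolutely_integrable_1)
  then have i2: "integrable lebesgue (\<lambda>s. indicator {0..t} s * s powr e)"
    by (simp add: set_integrable_def)
  show ?thesis
    unfolding set_integrable_def
  proof (rule Bochner_Integration.integrable_bound[OF Bochner_Integration.integrable_add[OF i1 i2]])
    show "(\<lambda>s. indicator {0<..t} s *\<^sub>R f s) \<in> borel_measurable lebesgue"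
      by (rule half_line_funs_truncated_measurable[OF f])
    show "AE s in lebesgue. norm (indicator {0<..t} s *\<^sub>R f s)
            \<le> norm (C * ?w s + indicator {0..t} s * s powr e)"
    proof (intro AE_I2)
      fix s
      show "norm (indicator {0<..t} s *\<^sub>R f s) \<le> norm (C * ?w s + indicator {0..t} s * s powr e)"
      proof (cases "0 < s \<and> s \<le> t")
        case True
        then show ?thesis using bnd[of s] by (auto simp: indicator_def)
      qed (auto simp: indicator_def)
    qed
  qed
qed

text \<open>The intervals differ at most in the point 0. This passes from the Lebesgue integral in
  \<open>hardy_op\<close> to the gauge integral, for which continuity and derivatives of the
  primitive are at hand.\<close>

lemma set_integral_eq_integral_closed:
  fixes f :: "real \<Rightarrow> real"
  assumes "set_integrable lebesgue {0<..t} f"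
  shows "f integrable_on {0..t}" "(LINT s:{0<..t}|lebesgue. f s) = integral {0..t} f"
proof -
  have neg: "negligible (({0<..t} - {0..t}) \<union> ({0..t} - {0<..t}))"
    by (rule negligible_subset[of "{0}"]) auto
  show "f integrable_on {0..t}"
    using set_lebesgue_integral_eq_integral(1)[OF assms] integrable_spike_set_eq[OF neg] by blast
  show "(LINT s:{0<..t}|lebesgue. f s) = integral {0..t} f"
    using set_lebesgue_integral_eq_integral(2)[OF assms] integral_spike_set[of "{0<..t}" "{0..t}" f]
      by (metis (no_types, lifting) neg negligible_Un_eq negligible_subset mem_Collect_eq sup_ge1 sup_ge2 subset_eq)
qed

lemma hardy_op_half_line_funs:
  assumes "\<And>t. set_integrable lebesgue {0<..t} f"
  shows "hardy_op f \<in> half_line_funs"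
proof (rule continuous_on_half_line_funs)
  have F: "continuous_on {0<..} (\<lambda>t. integral {0..t} f)"
  proof (intro continuous_at_imp_continuous_on ballI)
    fix x :: real assume "x \<in> {0<..}"
    moreover have "continuous_on {0..x+1} (\<lambda>t. integral {0..t} f)"
      by (rule indefinite_integral_continuous_1[OF set_integral_eq_integral_closed(1)[OF assms]])
    ultimately show "isCont (\<lambda>t. integral {0..t} f) x"
      by (intro continuous_on_interior[of "{0..x+1}"]) (auto simp: interior_atLeastAtMost_real)
  qed
  have "continuous_on {0<..} (\<lambda>t. (1 / t) * integral {0..t} f)"
    by (intro continuous_intros F) auto
  then show "continuous_on {0<..} (hardy_op f)"
    by (subst hardy_op_def[abs_def]) (simp add: set_integral_eq_integral_closed(2)[OF assms])
qed

section \<open>Passage to the limit under a dominating function\<close>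

text \<open>Dominated convergence on \<open>(0, t]\<close> gives pointwise convergence of the Hardy
  means. Fatou's lemma then handles the left-hand side, and dominated convergence under
  \<open>\<bar>g t\<bar> powr p * t powr a\<close> the right-hand side.\<close>

lemma weighted_bound_dominated_limit:
  assumes p: "1 \<le> p" and a: "a < p - 1"
    and g: "g \<in> half_line_funs" "weighted_pow p a g < \<infinity>"
    and u: "\<And>n. u n \<in> half_line_funs" "\<And>n t. 0 < t \<Longrightarrow> \<bar>u n t\<bar> \<le> \<bar>g t\<bar>"
    and f: "f \<in> half_line_funs"
    and lim: "AE t in lebesgue. 0 < t \<longrightarrow> (\<lambda>n. u n t) \<longlonglongrightarrow> f t"
    and bound: "\<And>n::nat. weighted_pow p a (\<lambda>t. hardy_op (u n) t - u n t)
                   \<le> ennreal M * weighted_pow p a (u n)"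
  shows "weighted_pow p a (\<lambda>t. hardy_op f t - f t) \<le> ennreal M * weighted_pow p a f"
proof -
  let ?L = "lebesgue_on {0<..} :: real measure"
  have lim': "AE t in ?L. (\<lambda>n. u n t) \<longlonglongrightarrow> f t"
    using lim by (subst AE_restrict_space_iff) auto
  have pos: "AE t in ?L. 0 < t"
    by (intro AE_I2) (simp add: space_restrict_space)
  have int_g: "set_integrable lebesgue {0<..t} g" for t
    by (rule weighted_pow_finite_imp_set_integrable[OF p a g])
  have le_g: "weighted_pow p a (u n) \<le> weighted_pow p a g" for n
    unfolding weighted_pow_eq
    using u(2)[of _ n] p by (intro nn_integral_mono) (auto simp: indicator_def intro!: ennreal_leI mult_right_mono powr_mono2)
  have int_u: "set_integrable lebesgue {0<..t} (u n)" for n t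
    using le_less_trans[OF le_g g(2)]
    by (intro weighted_pow_finite_imp_set_integrable[OF p a u(1)])
  have conv: "(\<lambda>n. LINT s:{0<..t}|lebesgue. u n s) \<longlonglongrightarrow> (LINT s:{0<..t}|lebesgue. f s)"
    and int_f: "set_integrable lebesgue {0<..t} f" for t
  proof -
    note m = half_line_funs_truncated_measurable
    have ig: "integrable lebesgue (\<lambda>s. norm (indicator {0<..t} s *\<^sub>R g s))"
      using int_g[of t] unfolding set_integrable_def by (rule integrable_norm)
    have l: "AE s in lebesgue. (\<lambda>n. indicator {0<..t} s *\<^sub>R u n s) \<longlonglongrightarrow> indicator {0<..t} s *\<^sub>R f s"
      using lim by eventually_elim (auto simp: indicator_def)
    have b: "AE s in lebesgue. norm (indicator {0<..t} s *\<^sub>R u n s) \<le> norm (indicator {0<..t} s *\<^sub>R g s)" for n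
      using u(2)[of _ n] by (intro AE_I2) (auto simp: indicator_def)
    show "(\<lambda>n. LINT s:{0<..t}|lebesgue. u n s) \<longlonglongrightarrow> (LINT s:{0<..t}|lebesgue. f s)"
      unfolding set_lebesgue_integral_def
      by (rule integral_dominated_convergence[OF m[OF f] m[OF u(1)] ig l b])
    show "set_integrable lebesgue {0<..t} f"
      unfolding set_integrable_def
      by (rule integrable_dominated_convergence[OF m[OF f] m[OF u(1)] ig l b])
  qed
  have H_u: "(\<lambda>t. hardy_op (u n) t - u n t) \<in> half_line_funs" for n
    using hardy_op_half_line_funs[OF int_u[of _ n]] u(1)[of n]
    unfolding half_line_funs_def by measurable
  have H_f: "(\<lambda>t. hardy_op f t - f t) \<in> half_line_funs"
    using hardy_op_half_line_funs[OF int_f] f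
    unfolding half_line_funs_def by measurable
  have powr_lim: "(\<lambda>n. ennreal (\<bar>x n\<bar> powr p * t powr a)) \<longlonglongrightarrow> ennreal (\<bar>y\<bar> powr p * t powr a)"
    if "x \<longlonglongrightarrow> y" for x y t
    using that p by (intro tendsto_ennrealI tendsto_intros tendsto_powr') (auto intro!: always_eventually)
  have lim_w: "(\<lambda>n. weighted_pow p a (u n)) \<longlonglongrightarrow> weighted_pow p a f"
    unfolding weighted_pow_def
  proof (rule nn_integral_dominated_convergence[where w = "\<lambda>t. ennreal (\<bar>g t\<bar> powr p * t powr a)"])
    show "AE t in ?L. ennreal (\<bar>u j t\<bar> powr p * t powr a) \<le> ennreal (\<bar>g t\<bar> powr p * t powr a)" for j
      using pos by eventually_elim (use u(2) p in \<open>auto intro!: ennreal_leI mult_right_mono powr_mono2\<close>)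
    show "AE t in ?L. (\<lambda>i. ennreal (\<bar>u i t\<bar> powr p * t powr a)) \<longlonglongrightarrow> ennreal (\<bar>f t\<bar> powr p * t powr a)"
      using lim' by eventually_elim (rule powr_lim)
  qed (fact weighted_integrand_measurable[OF u(1)] weighted_integrand_measurable[OF f]
      weighted_integrand_measurable[OF g(1)] g(2)[unfolded weighted_pow_def])+
  have "weighted_pow p a (\<lambda>t. hardy_op f t - f t)
      = (\<integral>\<^sup>+ t. liminf (\<lambda>n. ennreal (\<bar>hardy_op (u n) t - u n t\<bar> powr p * t powr a)) \<partial>?L)"
    unfolding weighted_pow_def
  proof (rule nn_integral_cong_AE)
    show "AE t in ?L. ennreal (\<bar>hardy_op f t - f t\<bar> powr p * t powr a) =
        liminf (\<lambda>n. ennreal (\<bar>hardy_op (u n) t - u n t\<bar> powr p * t powr a))"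
      using lim'
    proof eventually_elim
      case (elim t)
      have "(\<lambda>n. hardy_op (u n) t - u n t) \<longlonglongrightarrow> hardy_op f t - f t"
        unfolding hardy_op_def by (intro tendsto_intros conv elim)
      from powr_lim[OF this] show ?case
        by (intro lim_imp_Liminf[symmetric]) auto
    qed
  qed
  also have "\<dots> \<le> liminf (\<lambda>n. weighted_pow p a (\<lambda>t. hardy_op (u n) t - u n t))"
    unfolding weighted_pow_def
    by (rule nn_integral_liminf) (rule weighted_integrand_measurable[OF H_u])
  also have "\<dots> \<le> liminf (\<lambda>n. ennreal M * weighted_pow p a (u n))"
    by (intro Liminf_mono always_eventually allI bound)
  also have "\<dots> = ennreal M * weighted_pow p a f"
    by (intro lim_imp_Liminf ennreal_tendsto_cmult lim_w) auto
  finally show ?thesis .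
qed

section \<open>The inequality for continuous functions supported away from 0 and infinity\<close>

lemma has_real_derivative_abs_powr:
  fixes x p :: real
  assumes "1 < p"
  shows "((\<lambda>x. \<bar>x\<bar> powr p) has_real_derivative p * sgn x * \<bar>x\<bar> powr (p - 1)) (at x)"
proof -
  consider "0 < x" | "x < 0" | "x = 0" by linarith
  then show ?thesis
  proof cases
    case 1
    have "((\<lambda>x. x powr p) has_real_derivative p * x powr (p - 1)) (at x)"
      by (rule has_real_derivative_powr[OF 1])
    moreover have ev: "eventually (\<lambda>y. y powr p = \<bar>y\<bar> powr p) (nhds x)"
      using eventually_nhds_in_open[of "{0<..}" x] 1 by (auto elim!: eventually_mono)
    ultimately show ?thesis
      using 1 by (simp add: DERIV_cong_ev[OF refl ev refl])
  next
    case 2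
    have "((\<lambda>x. (- x) powr p) has_real_derivative p * (- x) powr (p - 1) * (- 1)) (at x)"
      using DERIV_chain2[OF has_real_derivative_powr[of "- x" p] DERIV_minus[OF DERIV_ident], of UNIV] 2
      by simp
    moreover have ev: "eventually (\<lambda>y. (- y) powr p = \<bar>y\<bar> powr p) (nhds x)"
      using eventually_nhds_in_open[of "{..<0}" x] 2 by (auto elim!: eventually_mono)
    ultimately show ?thesis
      using 2 by (simp add: DERIV_cong_ev[OF refl ev refl])
  next
    case 3
    \<comment> \<open>At 0 the difference quotient has absolute value
      \<open>\<bar>h\<bar> powr (p - 1)\<close>, which tends to 0 because
      \<open>1 < p\<close>.\<close>
    have "((\<lambda>h::real. \<bar>h\<bar> powr (p - 1)) \<longlongrightarrow> \<bar>0\<bar> powr (p - 1)) (at 0)"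
      using assms by (intro tendsto_powr' tendsto_intros) auto
    moreover have "\<forall>\<^sub>F h in at (0::real). \<bar>h\<bar> powr (p - 1) = norm (\<bar>h\<bar> powr p / h)"
      unfolding eventually_at_filter by (rule always_eventually) (simp add: powr_diff)
    ultimately have "((\<lambda>h::real. norm (\<bar>h\<bar> powr p / h)) \<longlongrightarrow> \<bar>0\<bar> powr (p - 1)) (at 0)"
      by (rule Lim_transform_eventually)
    then have "((\<lambda>h::real. \<bar>h\<bar> powr p / h) \<longlongrightarrow> 0) (at 0)"
      using assms by - (rule tendsto_norm_zero_cancel, simp)
    then show ?thesis
      using 3 by (simp add: DERIV_def)
  qed
qed

lemma nn_integral_continuous_interval:
  fixes N :: "real \<Rightarrow> real"
  assumes "continuous_on {l..T} N" "\<And>t. t \<in> {l..T} \<Longrightarrow> 0 \<le> N t"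
  shows "(\<integral>\<^sup>+ t. ennreal (N t) * indicator {l..T} t \<partial>lebesgue) = ennreal (integral {l..T} N)"
  unfolding nn_integral_completion
  by (rule nn_integral_has_integral_lebesgue'[OF assms(2) integrable_integral[OF integrable_continuous_real[OF assms(1)]]])

text \<open>
  For \<open>p = 1\<close> the function \<open>\<bar>F\<bar>\<close> need not be differentiable at zeros of \<open>F\<close>; this is why sign-changing
  \<open>f\<close> are allowed only for \<open>1 < p\<close>. Where \<open>F = 0\<close> the quotient \<open>f / g\<close> is not defined: there \<open>f = 0\<close> if
  \<open>f\<close> is nonnegative, and \<open>1 \<le> M\<close> is used otherwise.
\<close>

lemma weighted_bound_continuous:
  assumes p: "1 \<le> p" and a: "a < p - 1"
    and cont: "continuous_on UNIV f"
    and lu: "0 < l" "l \<le> u" and supp: "\<And>t. t \<le> l \<or> u \<le> t \<Longrightarrow> f t = 0"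
    and ineq: "\<And>x. 0 \<le> x \<Longrightarrow> \<bar>x - 1\<bar> powr p + c * (x - (p - 1 - a) / p) \<le> M * \<bar>x\<bar> powr p"
    and sign: "(\<forall>t. 0 \<le> f t) \<or> 1 < p \<and> 1 \<le> M \<and>
      (\<forall>x<0. \<bar>x - 1\<bar> powr p + c * (x - (p - 1 - a) / p) \<le> M * \<bar>x\<bar> powr p)"
  shows "weighted_pow p a (\<lambda>t. hardy_op f t - f t) \<le> ennreal M * weighted_pow p a f"
proof -
  define b where "b = (p - 1 - a) / p"
  have b: "0 < b" "p * b = p - 1 - a" using p a by (auto simp: b_def)
  \<comment> \<open>At \<open>x = b\<close> the linear term vanishes, so \<open>ineq\<close> at this
    point determines the sign of \<open>M\<close>.\<close>
  have M0: "0 \<le> M"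
  proof -
    have "\<bar>b - 1\<bar> powr p \<le> M * \<bar>b\<bar> powr p"
      using ineq[of b] b unfolding b_def[symmetric] by simp
    then have "0 \<le> M * \<bar>b\<bar> powr p"
      by (rule order_trans[OF powr_ge_zero])
    then show ?thesis using b by (simp add: zero_le_mult_iff)
  qed
  define F where "F t = integral {0..t} f" for t
  have contS: "continuous_on S f" for S using cont continuous_on_subset by blast
  have iof: "f integrable_on {s..t}" for s t by (rule integrable_continuous_real[OF contS])
  have hardy: "hardy_op f t = F t / t" if "0 < t" for t
  proof -
    have "set_integrable lebesgue {0..t} f"
      by (rule absolutely_integrable_continuous_real[OF contS])
    then have "set_integrable lebesgue {0<..t} f"
      by (rule set_integrable_subset) auto
    from set_integral_eq_integral_closed(2)[OF this] show ?thesis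
      by (simp add: hardy_op_def F_def)
  qed
  have F_deriv: "(F has_real_derivative f t) (at t)" if "0 < t" for t
  proof -
    have "(F has_real_derivative f t) (at t within {0..t + 1})"
      unfolding F_def[abs_def] using that by (intro integral_has_real_derivative contS) auto
    then show ?thesis using that by (simp add: at_within_Icc_at)
  qed
  have F_low: "F t = 0" if "t \<le> l" for t
    unfolding F_def using that supp by (intro integral_unique has_integral_is_0) auto
  have F_high: "F t = F u" if "u \<le> t" for t
  proof -
    have "integral {0..u} f + integral {u..t} f = integral {0..t} f"
      using that lu by (intro Henstock_Kurzweil_Integration.integral_combine iof) auto
    moreover have "integral {u..t} f = 0"
      using supp by (intro integral_unique has_integral_is_0) auto
    ultimately show ?thesis by (simp add: F_def)
  qed
  have F_nonneg: "0 \<le> F t" if "\<forall>t. 0 \<le> f t" for t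
    unfolding F_def using that by (intro Henstock_Kurzweil_Integration.integral_nonneg iof) auto
  \<comment> \<open>For \<open>p = 1\<close> only nonnegative \<open>f\<close> remain, so
    \<open>F\<close> is nonnegative and the identity can replace the absolute value, avoiding its
    corner at 0.\<close>
  define \<phi> where "\<phi> x = (if p = 1 then x else \<bar>x\<bar> powr p)" for x
  define \<phi>' where "\<phi>' x = (if p = 1 then 1 else p * sgn x * \<bar>x\<bar> powr (p - 1))" for x
  have \<phi>_deriv: "(\<phi> has_real_derivative \<phi>' x) (at x)" for x
    using has_real_derivative_abs_powr[of p x] p by (cases "p = 1") (auto simp: \<phi>_def[abs_def] \<phi>'_def)
  have \<phi>_0: "\<phi> 0 = 0" using p by (simp add: \<phi>_def)
  have \<phi>_F: "\<phi> (F t) = \<bar>F t\<bar> powr p" for t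
    using F_nonneg sign by (auto simp: \<phi>_def)
  have \<phi>_euler: "\<phi>' x * x = p * \<phi> x" for x
    by (auto simp: \<phi>_def \<phi>'_def powr_diff sgn_if)
  define \<Psi> where "\<Psi> t = t powr (a + 1 - p) * \<phi> (F t)" for t
  define \<Psi>' where "\<Psi>' t = (a + 1 - p) * t powr (a - p) * \<phi> (F t) + t powr (a + 1 - p) * (\<phi>' (F t) * f t)" for t
  have \<Psi>_deriv: "(\<Psi> has_real_derivative \<Psi>' t) (at t)" if "0 < t" for t
  proof -
    have "((\<lambda>t. \<phi> (F t)) has_real_derivative \<phi>' (F t) * f t) (at t)"
      by (rule DERIV_chain2[OF \<phi>_deriv F_deriv[OF that]])
    moreover have "((\<lambda>t. t powr (a + 1 - p)) has_real_derivative (a + 1 - p) * t powr (a - p)) (at t)"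
      using has_real_derivative_powr[OF that, of "a + 1 - p"] by simp
    ultimately show ?thesis
      unfolding \<Psi>_def[abs_def] \<Psi>'_def
      by (rule DERIV_mult'[rotated, THEN DERIV_cong]) simp
  qed
  define N where "N t = \<bar>F t / t - f t\<bar> powr p * t powr a" for t
  define W where "W t = \<bar>f t\<bar> powr p * t powr a" for t
  have pointwise: "N t \<le> M * W t - (c / p) * \<Psi>' t" if t: "0 < t" for t
  proof (cases "F t = 0")
    case True
    show ?thesis
    proof (cases "\<forall>t. 0 \<le> f t")
      case nonneg: True
      have "f t = 0"
      proof (rule DERIV_local_min[OF F_deriv[OF t] t])
        show "\<forall>y. \<bar>t - y\<bar> < t \<longrightarrow> F t \<le> F y"
          using True F_nonneg[OF nonneg] by simp
      qed
      then show ?thesis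
        using True p by (simp add: N_def W_def \<Psi>'_def \<phi>_0)
    next
      case False
      then have "1 < p" "1 \<le> M" using sign by auto
      moreover from this have "N t \<le> M * N t"
        by (intro mult_right_mono[of 1 M, simplified]) (auto simp: N_def)
      ultimately have "N t \<le> M * W t" "\<Psi>' t = 0"
        using True p by (auto simp: N_def W_def \<Psi>'_def \<phi>_0 \<phi>'_def)
      then show ?thesis by simp
    qed
  next
    case False
    \<comment> \<open>Here \<open>x\<close> is the mean called \<open>g\<close> in the opening
      outline, and \<open>r\<close> is the quotient \<open>f / g\<close>.\<close>
    define x where "x = F t / t"
    define r where "r = f t / x"
    have x: "x \<noteq> 0" "F t = x * t" "f t = r * x" using False t by (auto simp: x_def r_def)
    have "\<bar>r - 1\<bar> powr p + c * (r - b) \<le> M * \<bar>r\<bar> powr p"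
    proof (cases "0 \<le> r")
      case True
      then show ?thesis using ineq[of r] by (simp add: b_def)
    next
      case f2: False
      have "\<not> (\<forall>t. 0 \<le> f t)"
        using f2 F_nonneg[of t] t by (force simp: r_def x_def)
      with sign have "\<forall>x<0. \<bar>x - 1\<bar> powr p + c * (x - b) \<le> M * \<bar>x\<bar> powr p"
        unfolding b_def by blast
      then show ?thesis using f2 by (meson not_le)
    qed
    then have 1: "(\<bar>r - 1\<bar> powr p + c * (r - b)) * (\<bar>x\<bar> powr p * t powr a) \<le> M * \<bar>r\<bar> powr p * (\<bar>x\<bar> powr p * t powr a)"
      by (intro mult_right_mono) auto
    have 2: "\<bar>r - 1\<bar> powr p * \<bar>x\<bar> powr p = \<bar>F t / t - f t\<bar> powr p"
    proof -
      have "\<bar>F t / t - f t\<bar> = \<bar>r - 1\<bar> * \<bar>x\<bar>"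
        using t by (simp add: x flip: abs_mult) (simp add: algebra_simps abs_minus_commute)
      then show ?thesis by (simp add: powr_mult)
    qed
    have 3: "\<bar>r\<bar> powr p * \<bar>x\<bar> powr p = \<bar>f t\<bar> powr p"
      by (simp add: x abs_mult powr_mult)
    \<comment> \<open>Euler's identity for the homogeneous \<open>\<phi>\<close> turns
      \<open>\<phi>' (F t) * f t\<close> into a multiple of \<open>\<phi> (F t)\<close>; as
      \<open>p * b = p - 1 - a\<close>, both terms of \<open>\<Psi>'\<close> combine to the factor
      \<open>r - b\<close>.\<close>
    have 4: "\<Psi>' t = p * ((r - b) * (\<bar>x\<bar> powr p * t powr a))"
    proof -
      have 1: "t powr (a + 1 - p) = t powr (a - p) * t"
        using t by (simp add: powr_diff powr_add)
      have 2: "t powr (a - p) * \<phi> (F t) = \<bar>x\<bar> powr p * t powr a"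
        using t unfolding \<phi>_F unfolding x(2) by (simp add: abs_mult powr_mult powr_diff)
      have "t powr (a + 1 - p) * (\<phi>' (F t) * f t) = r * t powr (a - p) * (\<phi>' (F t) * F t)"
        by (simp add: 1 x(2,3))
      also have "\<dots> = p * r * (t powr (a - p) * \<phi> (F t))"
        by (simp add: \<phi>_euler)
      finally have 3: "t powr (a + 1 - p) * (\<phi>' (F t) * f t) = p * r * (\<bar>x\<bar> powr p * t powr a)"
        by (simp add: 2)
      have "\<Psi>' t = (a + 1 - p + p * r) * (\<bar>x\<bar> powr p * t powr a)"
        unfolding \<Psi>'_def 3 using 2 by (simp add: algebra_simps)
      also have "a + 1 - p + p * r = p * (r - b)" using b by (simp add: algebra_simps)
      finally show ?thesis by simp
    qed
    have "(\<bar>r - 1\<bar> powr p * \<bar>x\<bar> powr p) * t powr a + c * ((r - b) * (\<bar>x\<bar> powr p * t powr a))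
        \<le> M * ((\<bar>r\<bar> powr p * \<bar>x\<bar> powr p) * t powr a)"
      using 1 by (simp add: algebra_simps)
    moreover have "(c / p) * \<Psi>' t = c * ((r - b) * (\<bar>x\<bar> powr p * t powr a))"
      using p by (simp add: 4)
    ultimately show ?thesis
      unfolding 2 3 by (simp add: N_def W_def)
  qed
  have cF: "continuous_on {l..T} F" for T
    using lu by (intro continuous_at_imp_continuous_on ballI DERIV_isCont[OF F_deriv]) auto
  have cN: "continuous_on {l..T} N" for T
    unfolding N_def using lu p
    by (intro continuous_intros cF contS continuous_on_powr') auto
  have cW: "continuous_on {l..T} W" for T
    unfolding W_def using lu p
    by (intro continuous_intros contS continuous_on_powr') auto
  have N0: "0 \<le> N t" and W0: "0 \<le> W t" for t by (simp_all add: N_def W_def)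
  \<comment> \<open>The boundary term at \<open>l\<close> vanishes together with \<open>F\<close>;
    the one at \<open>T\<close> is kept in absolute value so that it fits into
    \<open>ennreal\<close>.\<close>
  have step: "(\<integral>\<^sup>+ t. ennreal (N t) * indicator {l..T} t \<partial>lebesgue)
      \<le> ennreal M * weighted_pow p a f + ennreal \<bar>c / p * \<Psi> T\<bar>" if T: "u \<le> T" for T
  proof -
    have "(\<Psi>' has_integral (\<Psi> T - \<Psi> l)) {l..T}"
      using T lu by (intro fundamental_theorem_of_calculus)
        (auto simp: has_real_derivative_iff_has_vector_derivative[symmetric] intro!: has_field_derivative_at_within[OF \<Psi>_deriv])
    moreover have "\<Psi> l = 0" by (simp add: \<Psi>_def F_low \<phi>_0)
    ultimately have "((\<lambda>t. M * W t - (c / p) * \<Psi>' t) has_integral (M * integral {l..T} W - (c / p) * \<Psi> T)) {l..T}"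
      by (intro has_integral_diff has_integral_mult_right integrable_integral integrable_continuous_real cW) auto
    then have "integral {l..T} N \<le> M * integral {l..T} W - (c / p) * \<Psi> T"
    proof (rule has_integral_le[OF integrable_integral[OF integrable_continuous_real[OF cN]]])
      show "N x \<le> M * W x - (c / p) * \<Psi>' x" if "x \<in> {l..T}" for x
        using that lu by (intro pointwise) auto
    qed
    also have "\<dots> \<le> M * integral {l..T} W + \<bar>c / p * \<Psi> T\<bar>" by linarith
    finally have "ennreal (integral {l..T} N) \<le> ennreal (M * integral {l..T} W + \<bar>c / p * \<Psi> T\<bar>)"
      by (rule ennreal_leI)
    also have "\<dots> = ennreal M * ennreal (integral {l..T} W) + ennreal \<bar>c / p * \<Psi> T\<bar>"
      using M0 W0 by (subst ennreal_plus) (auto simp: ennreal_mult' intro!: mult_nonneg_nonneg Henstock_Kurzweil_Integration.integral_nonneg integrable_continuous_real cW)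
    also have "ennreal (integral {l..T} W) \<le> weighted_pow p a f"
      unfolding weighted_pow_eq nn_integral_continuous_interval[OF cW W0, symmetric]
      using lu by (intro nn_integral_mono) (auto simp: W_def indicator_def)
    finally show ?thesis
      by (simp add: nn_integral_continuous_interval[OF cN N0] add_right_mono mult_left_mono)
  qed
  \<comment> \<open>Left of \<open>l\<close> both \<open>f\<close> and its mean vanish, so the
    windows \<open>{l..u + real n}\<close> exhaust the integral, and Fatou's lemma reduces it to
    \<open>step\<close>.\<close>
  have "weighted_pow p a (\<lambda>t. hardy_op f t - f t) =
      (\<integral>\<^sup>+ t. liminf (\<lambda>n. ennreal (N t) * indicator {l..u + real n} t) \<partial>lebesgue)"
    unfolding weighted_pow_eq
  proof (rule nn_integral_cong)
    fix t :: real
    show "ennreal (\<bar>hardy_op f t - f t\<bar> powr p * t powr a) * indicator {0<..} t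
        = liminf (\<lambda>n. ennreal (N t) * indicator {l..u + real n} t)"
    proof (cases "l \<le> t")
      case True
      have "\<forall>\<^sub>F n in sequentially. t \<le> u + real n"
        using eventually_ge_at_top[of "nat \<lceil>t - u\<rceil>"] by eventually_elim linarith
      then have "\<forall>\<^sub>F n in sequentially. ennreal (N t) * indicator {l..u + real n} t = ennreal (N t)"
        by eventually_elim (use True in \<open>simp add: indicator_def\<close>)
      then have "(\<lambda>n. ennreal (N t) * indicator {l..u + real n} t) \<longlonglongrightarrow> ennreal (N t)"
        by (rule tendsto_eventually)
      from lim_imp_Liminf[OF _ this] show ?thesis
        using True lu by (simp add: N_def hardy)
    next
      case False
      then have "(\<lambda>n. ennreal (N t) * indicator {l..u + real n} t) = (\<lambda>n. 0)" by (auto simp: indicator_def)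
      moreover have "liminf (\<lambda>n::nat. 0::ennreal) = 0" by (simp add: Liminf_const)
      ultimately show ?thesis
        using False p supp[of t] by (auto simp: indicator_def hardy F_low)
    qed
  qed
  also have "\<dots> \<le> liminf (\<lambda>n. \<integral>\<^sup>+ t. ennreal (N t) * indicator {l..u + real n} t \<partial>lebesgue)"
  proof (rule nn_integral_liminf)
    fix n
    have "(\<lambda>t. indicator {l..u + real n} t *\<^sub>R N t) \<in> borel_measurable borel"
      by (rule borel_measurable_continuous_on_indicator[OF _ cN]) auto
    then have "(\<lambda>t. indicator {l..u + real n} t *\<^sub>R N t) \<in> borel_measurable lebesgue"
      by (simp add: measurable_completion)
    then have "(\<lambda>t. ennreal (indicator {l..u + real n} t *\<^sub>R N t)) \<in> borel_measurable lebesgue"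
      by measurable
    also have "(\<lambda>t. ennreal (indicator {l..u + real n} t *\<^sub>R N t)) = (\<lambda>t. ennreal (N t) * indicator {l..u + real n} t)"
      by (auto simp: indicator_def)
    finally show "(\<lambda>t. ennreal (N t) * indicator {l..u + real n} t) \<in> borel_measurable lebesgue" .
  qed
  also have "\<dots> \<le> liminf (\<lambda>n. ennreal M * weighted_pow p a f + ennreal \<bar>c / p * \<Psi> (u + real n)\<bar>)"
    by (intro Liminf_mono always_eventually allI step) auto
  \<comment> \<open>\<open>F\<close> is constant from \<open>u\<close> on and the exponent
    \<open>a + 1 - p\<close> is negative, so the boundary term tends to 0.\<close>
  also have "\<dots> = ennreal M * weighted_pow p a f + 0"
  proof (intro lim_imp_Liminf tendsto_add tendsto_const)
    have "(\<lambda>n. (u + real n) powr (a + 1 - p)) \<longlonglongrightarrow> 0"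
      using a by (intro tendsto_neg_powr filterlim_tendsto_add_at_top[OF tendsto_const filterlim_real_sequentially]) auto
    then have "(\<lambda>n. \<bar>c / p * ((u + real n) powr (a + 1 - p) * \<phi> (F u))\<bar>) \<longlonglongrightarrow> \<bar>c / p * (0 * \<phi> (F u))\<bar>"
      by (intro tendsto_intros)
    moreover have "\<Psi> (u + real n) = (u + real n) powr (a + 1 - p) * \<phi> (F u)" for n
      using F_high[of "u + real n"] by (simp add: \<Psi>_def)
    ultimately have "(\<lambda>n. \<bar>c / p * \<Psi> (u + real n)\<bar>) \<longlonglongrightarrow> 0" by simp
    from tendsto_ennrealI[OF this]
    show "(\<lambda>n. ennreal \<bar>c / p * \<Psi> (u + real n)\<bar>) \<longlonglongrightarrow> 0" by simp
  qed auto
  finally show ?thesis by simp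
qed

section \<open>Approximation of measurable functions\<close>

text \<open>A continuous cutoff that for \<open>0 < m\<close> lives on \<open>[1 / m, m]\<close>; it
  supplies the compact support demanded by \<open>weighted_bound_continuous\<close>.\<close>

definition tent :: "nat \<Rightarrow> real \<Rightarrow> real" where
  "tent m t = max 0 (min 1 (min (real m * t - 1) (real m - t)))"

lemma tent_bounds: "0 \<le> tent m t" "tent m t \<le> 1"
  by (auto simp: tent_def)

lemma tent_zero: "0 < m \<Longrightarrow> t \<le> 1 / real m \<or> real m \<le> t \<Longrightarrow> tent m t = 0"
  by (auto simp: tent_def field_simps)

lemma continuous_on_tent: "continuous_on S (tent m)"
  unfolding tent_def by (intro continuous_intros)

lemma tent_limit:
  assumes "0 < t"
  shows "\<forall>\<^sub>F m in sequentially. tent m t = 1"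
proof -
  have "\<forall>\<^sub>F m in sequentially. 2 / t \<le> real m" "\<forall>\<^sub>F m in sequentially. t + 1 \<le> real m"
    by (rule eventually_ge_at_top[THEN filterlim_real_sequentially[THEN filterlim_iff[THEN iffD1], rule_format]])+
  then show ?thesis
    by eventually_elim (use assms in \<open>auto simp: tent_def field_simps\<close>)
qed

text \<open>Two approximations are chained: \<open>f\<close> is the limit of bounded, compactly
  supported \<open>h m\<close> dominated by \<open>f\<close>, and each \<open>h m\<close> is an
  almost everywhere limit of continuous \<open>q n\<close> dominated by a multiple of the
  cutoff.\<close>

lemma weighted_pow_sufficient:
  assumes p: "1 \<le> p" and a: "a < p - 1"
    and f: "f \<in> half_line_funs" and fin: "weighted_pow p a f < \<infinity>"
    and ineq: "\<And>x. 0 \<le> x \<Longrightarrow> \<bar>x - 1\<bar> powr p + c * (x - (p - 1 - a) / p) \<le> M * \<bar>x\<bar> powr p"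
    and sign: "(\<forall>t>0. 0 \<le> f t) \<or> 1 < p \<and> 1 \<le> M \<and>
      (\<forall>x<0. \<bar>x - 1\<bar> powr p + c * (x - (p - 1 - a) / p) \<le> M * \<bar>x\<bar> powr p)"
  shows "weighted_pow p a (\<lambda>t. hardy_op f t - f t) \<le> ennreal M * weighted_pow p a f"
proof -
  \<comment> \<open>If \<open>f\<close> is nonnegative, clipping from below at 0 makes the
    continuous approximants nonnegative as well, as the first alternative of \<open>sign\<close>
    demands.\<close>
  define lo where "lo m = (if \<forall>t>0. 0 \<le> f t then 0 else - real m)" for m
  define cl where "cl m x = max (lo m) (min (real m) x)" for m x
  \<comment> \<open>The shift to \<open>Suc m\<close> keeps the left end
    \<open>1 / real (Suc m)\<close> of the support positive; index 0 would give 0.\<close>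
  define h where "h m t = tent (Suc m) t * cl (Suc m) (f t)" for m t
  have cl_le: "\<bar>cl m x\<bar> \<le> real m" for m x by (auto simp: cl_def lo_def)
  have cl_cont: "continuous_on S (cl m)" for S m unfolding cl_def by (intro continuous_intros)
  have cl_f: "\<bar>cl m (f t)\<bar> \<le> \<bar>f t\<bar>" if "0 < t" for m t
    using that by (auto simp: cl_def lo_def)
  have fm: "f \<in> borel_measurable (lebesgue_on {0<..})" using f by (simp add: half_line_funs_def)
  have tent_m: "tent m \<in> borel_measurable (lebesgue_on {0<..})" for m
    using continuous_on_half_line_funs[OF continuous_on_tent] by (simp add: half_line_funs_def)
  have h_meas: "h m \<in> half_line_funs" for m
    using fm tent_m unfolding half_line_funs_def h_def cl_def by measurable
  have bound_h: "weighted_pow p a (\<lambda>t. hardy_op (h m) t - h m t) \<le> ennreal M * weighted_pow p a (h m)" for m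
  proof -
    define m' where "m' = Suc m"
    define g where "g t = real m' * tent m' t" for t
    have "(\<lambda>t. indicator {0<..} t * f t) \<in> borel_measurable lebesgue"
      using f by (simp add: half_line_funs_iff)
    \<comment> \<open>Measurability yields continuous functions converging off a negligible set;
      clipping and cutting them off produces a common bound.\<close>
    then have "(\<lambda>t. indicator {0<..} t * f t) measurable_on UNIV"
      by (rule lebesgue_measurable_imp_measurable_on) simp
    then obtain Z v where Z: "negligible Z" and v: "\<And>n::nat. continuous_on UNIV (v n)"
      and lim: "\<And>x. x \<notin> Z \<Longrightarrow> (\<lambda>n. v n x) \<longlonglongrightarrow> indicator {0<..} x * f x"
      unfolding measurable_on_def by auto
    define q where "q n t = tent m' t * cl m' (v n t)" for n t
    have q_cont: "continuous_on S (q n)" for S n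
      unfolding q_def
      using v[of n] by (intro continuous_intros continuous_on_tent continuous_on_compose2[OF cl_cont])
        (auto intro: continuous_on_subset)
    show ?thesis
    proof (rule weighted_bound_dominated_limit[OF p a, where g = g and u = q])
      show "g \<in> half_line_funs"
        unfolding g_def by (intro continuous_on_half_line_funs continuous_intros continuous_on_tent)
      have gz: "g t = 0" if "t < 1 / real m' \<or> real m' < t" for t
        using that tent_zero[of m' t] by (auto simp: g_def m'_def)
      let ?J = "{1 / real m'..real m'}"
      have "weighted_pow p a g \<le> (\<integral>\<^sup>+ t. ennreal (\<bar>g t\<bar> powr p * t powr a) * indicator ?J t \<partial>lebesgue)"
        unfolding weighted_pow_eq using p gz by (intro nn_integral_mono) (auto simp: indicator_def not_le)
      also have "\<dots> < \<infinity>"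
      proof (subst nn_integral_continuous_interval)
        show "continuous_on ?J (\<lambda>t. \<bar>g t\<bar> powr p * t powr a)"
          unfolding g_def using p
          by (intro continuous_intros continuous_on_powr' continuous_on_tent)
            (auto simp: m'_def dest: order.strict_trans2[of 0 "1 / real (Suc m)"])
      qed auto
      finally show "weighted_pow p a g < \<infinity>" .
      show "q n \<in> half_line_funs" for n by (rule continuous_on_half_line_funs[OF q_cont])
      show "\<bar>q n t\<bar> \<le> \<bar>g t\<bar>" for n t
        using mult_left_mono[OF cl_le[of m' "v n t"] tent_bounds(1)[of m' t]] tent_bounds(1)[of m' t]
        by (simp add: q_def g_def abs_mult mult.commute)
      show "h m \<in> half_line_funs" by (rule h_meas)
      have "AE t in lebesgue. t \<notin> Z"
        using Z by (simp add: negligible_iff_null_sets AE_not_in)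
      then show "AE t in lebesgue. 0 < t \<longrightarrow> (\<lambda>n. q n t) \<longlonglongrightarrow> h m t"
      proof eventually_elim
        case (elim t)
        have "(\<lambda>n. q n t) \<longlonglongrightarrow> tent m' t * cl m' (indicator {0<..} t * f t)"
          unfolding q_def cl_def using lim[OF elim] by (intro tendsto_intros)
        then show ?case by (auto simp: h_def m'_def)
      qed
      show "weighted_pow p a (\<lambda>t. hardy_op (q n) t - q n t) \<le> ennreal M * weighted_pow p a (q n)" for n
      proof (rule weighted_bound_continuous[OF p a q_cont, of "1 / real m'" "real m'"])
        show "1 / real m' \<le> real m'" "0 < 1 / real m'" by (auto simp: m'_def field_simps)
        show "q n t = 0" if "t \<le> 1 / real m' \<or> real m' \<le> t" for t
          using tent_zero[OF _ that] by (simp add: q_def m'_def)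
        show "(\<forall>t. 0 \<le> q n t) \<or> 1 < p \<and> 1 \<le> M \<and>
            (\<forall>x<0. \<bar>x - 1\<bar> powr p + c * (x - (p - 1 - a) / p) \<le> M * \<bar>x\<bar> powr p)"
          using sign by (auto simp: q_def cl_def lo_def tent_bounds)
      qed (rule ineq)
    qed
  qed
  show ?thesis
  proof (rule weighted_bound_dominated_limit[OF p a f fin h_meas _ f _ bound_h])
    show "\<bar>h m t\<bar> \<le> \<bar>f t\<bar>" if "0 < t" for m t
      using mult_mono[OF tent_bounds(2)[of "Suc m" t] cl_f[OF that, of "Suc m"]] tent_bounds(1)[of "Suc m" t]
      by (simp add: h_def abs_mult)
    have "(\<lambda>m. h m t) \<longlonglongrightarrow> f t" if t: "0 < t" for t
    proof -
      have "\<forall>\<^sub>F m in sequentially. \<bar>f t\<bar> \<le> real m"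
        by (rule eventually_ge_at_top[THEN filterlim_real_sequentially[THEN filterlim_iff[THEN iffD1], rule_format]])
      then have "\<forall>\<^sub>F m in sequentially. tent m t * cl m (f t) = f t"
        using tent_limit[OF t] by eventually_elim (use t in \<open>auto simp: cl_def lo_def\<close>)
      then have "(\<lambda>m. tent m t * cl m (f t)) \<longlonglongrightarrow> f t" by (rule tendsto_eventually)
      from LIMSEQ_Suc[OF this] show ?thesis by (simp add: h_def)
    qed
    then show "AE t in lebesgue. 0 < t \<longrightarrow> (\<lambda>m. h m t) \<longlonglongrightarrow> f t" by auto
  qed
qed

section \<open>Two-power test functions and the lower bounds they give\<close>

lemma nn_integral_powr_from_0:
  assumes "- 1 < e" "0 \<le> C"
  shows "(\<integral>\<^sup>+ t. ennreal (C * t powr e) * indicator {0..1} t \<partial>lborel) = ennreal (C / (e + 1))"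
  using nn_integral_has_integral_lebesgue'[OF _ has_integral_mult_right[OF has_integral_powr_from_0[OF assms(1), of 1], of C]]
    assms by simp

lemma nn_integral_powr_to_inf:
  assumes "e < - 1" "0 \<le> C"
  shows "(\<integral>\<^sup>+ t. ennreal (C * t powr e) * indicator {1..} t \<partial>lborel) = ennreal (C / - (e + 1))"
  using nn_integral_has_integral_lebesgue'[OF _ has_integral_mult_right[OF has_integral_powr_to_inf[OF assms(1), of 1], of C]]
    assms by (simp add: minus_divide_right)

text \<open>Coefficients are kept separate from exponents so that the test function, its Hardy mean
  and their difference all have this form.\<close>

definition two_powers :: "real \<Rightarrow> real \<Rightarrow> real \<Rightarrow> real \<Rightarrow> real \<Rightarrow> real" where
  "two_powers A \<alpha> B \<beta> t = (if t \<le> 1 then B * t powr (\<beta> - 1) else A * t powr (\<alpha> - 1))"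

lemma two_powers_half_line_funs: "two_powers A \<alpha> B \<beta> \<in> half_line_funs"
proof -
  have "(\<lambda>t. indicator {0<..} t * two_powers A \<alpha> B \<beta> t) \<in> borel_measurable borel"
    unfolding two_powers_def by measurable
  then show ?thesis
    by (simp add: half_line_funs_iff measurable_completion)
qed

text \<open>For either exponent \<open>\<gamma>\<close>, the power in the weighted integrand plus 1
  is \<open>p * (\<gamma> - b)\<close>, so \<open>\<alpha> < b < \<beta>\<close> is exactly
  convergence at infinity and at 0.\<close>

lemma weighted_pow_two_powers:
  assumes p: "1 \<le> p" and \<alpha>: "\<alpha> < (p - 1 - a) / p" and \<beta>: "(p - 1 - a) / p < \<beta>"
  shows "weighted_pow p a (two_powers A \<alpha> B \<beta>) =
    ennreal (\<bar>B\<bar> powr p / (p * (\<beta> - (p - 1 - a) / p)) + \<bar>A\<bar> powr p / (p * ((p - 1 - a) / p - \<alpha>)))"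
proof -
  define b where "b = (p - 1 - a) / p"
  have b: "p * b = p - 1 - a" using p by (simp add: b_def)
  let ?e = "\<lambda>\<gamma>. p * (\<gamma> - 1) + a"
  have e1: "?e \<gamma> + 1 = p * (\<gamma> - b)" for \<gamma> using b by (simp add: algebra_simps)
  have lt: "?e \<alpha> < - 1" "- 1 < ?e \<beta>"
  proof -
    have "?e \<alpha> + 1 < 0"
      unfolding e1 using p \<alpha> by (intro mult_pos_neg) (auto simp: b_def)
    then show "?e \<alpha> < - 1" by linarith
    have "0 < ?e \<beta> + 1"
      unfolding e1 using p \<beta> by (intro mult_pos_pos) (auto simp: b_def)
    then show "- 1 < ?e \<beta>" by linarith
  qed
  have pw: "\<bar>C * t powr (\<gamma> - 1)\<bar> powr p * t powr a = \<bar>C\<bar> powr p * t powr ?e \<gamma>" if "0 < t" for C \<gamma> t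
    using that by (simp add: abs_mult powr_mult powr_powr powr_add mult.commute[of p])
  have "weighted_pow p a (two_powers A \<alpha> B \<beta>) =
      (\<integral>\<^sup>+ t. ennreal (\<bar>B\<bar> powr p * t powr ?e \<beta>) * indicator {0..1} t
           + ennreal (\<bar>A\<bar> powr p * t powr ?e \<alpha>) * indicator {1..} t \<partial>lborel)"
    unfolding weighted_pow_eq nn_integral_completion
  proof (rule nn_integral_cong_AE)
    show "AE t in lborel. ennreal (\<bar>two_powers A \<alpha> B \<beta> t\<bar> powr p * t powr a) * indicator {0<..} t =
      ennreal (\<bar>B\<bar> powr p * t powr ?e \<beta>) * indicator {0..1} t
           + ennreal (\<bar>A\<bar> powr p * t powr ?e \<alpha>) * indicator {1..} t"
      using AE_lborel_singleton[of 1]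
    proof eventually_elim
      case (elim t)
      consider "t \<le> 0" | "0 < t" "t < 1" | "1 < t" using elim by linarith
      then show ?case
        by cases (auto simp: two_powers_def pw indicator_def)
    qed
  qed
  also have "\<dots> = ennreal (\<bar>B\<bar> powr p / (?e \<beta> + 1)) + ennreal (\<bar>A\<bar> powr p / - (?e \<alpha> + 1))"
    by (subst nn_integral_add) (simp_all add: nn_integral_powr_from_0 nn_integral_powr_to_inf lt)
  also have "\<dots> = ennreal (\<bar>B\<bar> powr p / (p * (\<beta> - b)) + \<bar>A\<bar> powr p / (p * (b - \<alpha>)))"
  proof -
    have "- (?e \<alpha> + 1) = p * (b - \<alpha>)" unfolding e1 by (simp add: algebra_simps)
    moreover have "0 \<le> \<bar>B\<bar> powr p / (p * (\<beta> - b))" "0 \<le> \<bar>A\<bar> powr p / (p * (b - \<alpha>))"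
      using p \<alpha> \<beta> by (simp_all add: b_def)
    ultimately show ?thesis by (simp only: e1 ennreal_plus)
  qed
  finally show ?thesis by (simp add: b_def)
qed

text \<open>The primitive is \<open>t powr \<beta>\<close> up to 1 and
  \<open>t powr \<alpha>\<close> beyond. The two agree at 1, which explains the coefficients
  \<open>\<beta>\<close> and \<open>\<alpha>\<close>.\<close>

lemma hardy_op_two_powers:
  assumes p: "1 \<le> p" and a: "a < p - 1" and \<alpha>: "\<alpha> < (p - 1 - a) / p" and \<beta>: "(p - 1 - a) / p < \<beta>"
    and t: "0 < t"
  shows "hardy_op (two_powers \<alpha> \<alpha> \<beta> \<beta>) t = two_powers 1 \<alpha> 1 \<beta> t"
proof -
  let ?f = "two_powers \<alpha> \<alpha> \<beta> \<beta>"
  have "0 < (p - 1 - a) / p" using p a by simp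
  then have \<beta>0: "0 < \<beta>" using \<beta> by linarith
  have int: "set_integrable lebesgue {0<..t} ?f" for t
    by (rule weighted_pow_finite_imp_set_integrable[OF p a two_powers_half_line_funs])
      (simp add: weighted_pow_two_powers[OF p \<alpha> \<beta>])
  have low: "(?f has_integral s powr \<beta>) {0..s}" if "0 \<le> s" "s \<le> 1" for s
  proof -
    have "((\<lambda>x. \<beta> * x powr (\<beta> - 1)) has_integral (\<beta> * (s powr (\<beta> - 1 + 1) / (\<beta> - 1 + 1)))) {0..s}"
      using that \<beta>0 by (intro has_integral_mult_right has_integral_powr_from_0) auto
    then have "((\<lambda>x. \<beta> * x powr (\<beta> - 1)) has_integral s powr \<beta>) {0..s}"
      using \<beta>0 by simp
    then show ?thesis
      by (rule has_integral_eq[rotated]) (use that in \<open>simp add: two_powers_def\<close>)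
  qed
  have high: "(?f has_integral (s powr \<alpha> - 1)) {1..s}" if "1 \<le> s" for s
  proof -
    have "((\<lambda>x. \<alpha> * x powr (\<alpha> - 1)) has_integral (s powr \<alpha> - 1 powr \<alpha>)) {1..s}"
    proof (rule fundamental_theorem_of_calculus[OF that])
      fix x assume "x \<in> {1..s}"
      then have "0 < x" by auto
      from has_real_derivative_powr[OF this, of \<alpha>]
      show "((\<lambda>x. x powr \<alpha>) has_vector_derivative \<alpha> * x powr (\<alpha> - 1)) (at x within {1..s})"
        by (simp add: has_real_derivative_iff_has_vector_derivative has_vector_derivative_at_within)
    qed
    \<comment> \<open>At the left end point 1 \<open>two_powers\<close> still takes its first
      branch, hence the exceptional point.\<close>
    from has_integral_spike_finite[of "{1}" _ ?f, OF _ _ this] show ?thesis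
      by (simp add: two_powers_def)
  qed
  have "integral {0..t} ?f = (if t \<le> 1 then t powr \<beta> else t powr \<alpha>)"
  proof (cases "t \<le> 1")
    case True
    then show ?thesis using low[of t] t by (simp add: integral_unique)
  next
    case False
    then have "(?f has_integral (1 powr \<beta> + (t powr \<alpha> - 1))) {0..t}"
      by (intro has_integral_combine[OF _ _ low high]) auto
    then show ?thesis using False by (simp add: integral_unique)
  qed
  then show ?thesis
    unfolding hardy_op_def set_integral_eq_integral_closed(2)[OF int]
    using t by (simp add: two_powers_def powr_diff)
qed

text \<open>For the test function both weighted integrals are explicit; clearing the denominators
  \<open>p * (\<beta> - b)\<close> and \<open>p * (b - \<alpha>)\<close> turns their quotient into
  \<open>k_fun\<close>.\<close>

lemma k_fun_le_hardy_bound: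
  assumes p: "1 \<le> p" and a: "a < p - 1" and \<alpha>: "\<alpha> < (p - 1 - a) / p" and \<beta>: "(p - 1 - a) / p < \<beta>"
    and F: "two_powers \<alpha> \<alpha> \<beta> \<beta> \<in> F" and K: "hardy_bound F p a K"
  shows "k_fun p a \<alpha> \<beta> \<le> K powr p"
proof -
  let ?f = "two_powers \<alpha> \<alpha> \<beta> \<beta>"
  define b where "b = (p - 1 - a) / p"
  have "0 < b" using p a by (simp add: b_def)
  then have \<beta>0: "0 < \<beta>" and d: "0 < b - \<alpha>" "0 < \<beta> - b" using \<alpha> \<beta> by (simp_all add: b_def)
  have "weighted_pow p a (\<lambda>t. hardy_op ?f t - ?f t) = weighted_pow p a (two_powers (1 - \<alpha>) \<alpha> (1 - \<beta>) \<beta>)"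
    unfolding weighted_pow_eq
  proof (rule nn_integral_cong)
    fix t
    show "ennreal (\<bar>hardy_op ?f t - ?f t\<bar> powr p * t powr a) * indicator {0<..} t =
       ennreal (\<bar>two_powers (1 - \<alpha>) \<alpha> (1 - \<beta>) \<beta> t\<bar> powr p * t powr a) * indicator {0<..} t"
    proof (cases "0 < t")
      case True
      then have "hardy_op ?f t - ?f t = two_powers (1 - \<alpha>) \<alpha> (1 - \<beta>) \<beta> t"
        by (simp add: hardy_op_two_powers[OF p a \<alpha> \<beta>]) (simp add: two_powers_def algebra_simps)
      then show ?thesis by simp
    qed simp
  qed
  moreover have "weighted_pow p a (\<lambda>t. hardy_op ?f t - ?f t) \<le> ennreal (K powr p) * weighted_pow p a ?f"
  proof -
    have "weighted_pow p a ?f < \<infinity>" by (simp add: weighted_pow_two_powers[OF p \<alpha> \<beta>])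
    then show ?thesis using K F unfolding hardy_bound_def by blast
  qed
  ultimately have "ennreal (\<bar>1 - \<beta>\<bar> powr p / (p * (\<beta> - b)) + \<bar>1 - \<alpha>\<bar> powr p / (p * (b - \<alpha>)))
      \<le> ennreal (K powr p * (\<bar>\<beta>\<bar> powr p / (p * (\<beta> - b)) + \<bar>\<alpha>\<bar> powr p / (p * (b - \<alpha>))))"
    by (simp add: weighted_pow_two_powers[OF p \<alpha> \<beta>] ennreal_mult' b_def)
  moreover have "0 \<le> \<bar>\<beta>\<bar> powr p / (p * (\<beta> - b)) + \<bar>\<alpha>\<bar> powr p / (p * (b - \<alpha>))"
    using d p by (intro add_nonneg_nonneg divide_nonneg_nonneg mult_nonneg_nonneg) auto
  ultimately have "\<bar>1 - \<beta>\<bar> powr p / (p * (\<beta> - b)) + \<bar>1 - \<alpha>\<bar> powr p / (p * (b - \<alpha>))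
      \<le> K powr p * (\<bar>\<beta>\<bar> powr p / (p * (\<beta> - b)) + \<bar>\<alpha>\<bar> powr p / (p * (b - \<alpha>)))"
    using ennreal_le_iff mult_nonneg_nonneg[OF powr_ge_zero] by blast
  then have "(p * (\<beta> - b) * (b - \<alpha>)) * (\<bar>1 - \<beta>\<bar> powr p / (p * (\<beta> - b)) + \<bar>1 - \<alpha>\<bar> powr p / (p * (b - \<alpha>)))
      \<le> (p * (\<beta> - b) * (b - \<alpha>)) * (K powr p * (\<bar>\<beta>\<bar> powr p / (p * (\<beta> - b)) + \<bar>\<alpha>\<bar> powr p / (p * (b - \<alpha>))))"
    using d p by (intro mult_left_mono) auto
  moreover have "(p * (\<beta> - b) * (b - \<alpha>)) * (x / (p * (\<beta> - b)) + y / (p * (b - \<alpha>))) = (\<beta> - b) * y + (b - \<alpha>) * x" for x y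
    using d p by (simp add: divide_simps)
  ultimately have "(\<beta> - b) * \<bar>\<alpha> - 1\<bar> powr p + (b - \<alpha>) * \<bar>\<beta> - 1\<bar> powr p
      \<le> K powr p * ((\<beta> - b) * \<bar>\<alpha>\<bar> powr p + (b - \<alpha>) * \<bar>\<beta>\<bar> powr p)"
    by (simp add: abs_minus_commute mult.left_commute)
  moreover have "0 < (\<beta> - b) * \<bar>\<alpha>\<bar> powr p + (b - \<alpha>) * \<bar>\<beta>\<bar> powr p"
    using d \<beta>0 by (intro add_nonneg_pos) auto
  ultimately show ?thesis
    by (simp add: k_fun_def b_def[symmetric] divide_le_eq)
qed

lemma two_powers_positive_funs:
  assumes "0 \<le> \<alpha>" "0 \<le> \<beta>"
  shows "two_powers \<alpha> \<alpha> \<beta> \<beta> \<in> positive_funs"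
  using assms by (auto simp: positive_funs_def two_powers_half_line_funs two_powers_def)

text \<open>Both exponents are at most 0, so each piece decreases, and
  \<open>\<alpha> \<le> \<beta>\<close> prevents an upward jump at 1.\<close>

lemma two_powers_positive_decreasing_funs:
  assumes "0 \<le> \<alpha>" "\<alpha> \<le> \<beta>" "\<beta> \<le> 1"
  shows "two_powers \<alpha> \<alpha> \<beta> \<beta> \<in> positive_decreasing_funs"
proof -
  have "two_powers \<alpha> \<alpha> \<beta> \<beta> t \<le> two_powers \<alpha> \<alpha> \<beta> \<beta> s" if "0 < s" "s \<le> t" for s t
  proof -
    have mono: "t powr (\<gamma> - 1) \<le> s powr (\<gamma> - 1)" if "\<gamma> \<le> 1" for \<gamma>
      using \<open>0 < s\<close> \<open>s \<le> t\<close> that by (intro powr_mono2') auto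
    show ?thesis
    proof (cases "s \<le> 1 \<and> 1 < t")
      case True
      have "\<alpha> * t powr (\<alpha> - 1) \<le> \<alpha> * 1"
        using True assms powr_mono2'[of "\<alpha> - 1" 1 t] by (intro mult_left_mono) auto
      also have "\<dots> \<le> \<beta> * s powr (\<beta> - 1)"
        using True assms that powr_mono2'[of "\<beta> - 1" s 1] by (intro mult_mono) auto
      finally show ?thesis using True by (simp add: two_powers_def)
    next
      case False
      then show ?thesis
        using that assms mono[of \<alpha>] mono[of \<beta>]
        by (auto simp: two_powers_def intro!: mult_left_mono)
    qed
  qed
  then show ?thesis
    using two_powers_positive_funs[of \<alpha> \<beta>] assms
    by (auto simp: positive_decreasing_funs_def monotone_on_def)
qed

section \<open>Admissible constants and their minimum\<close>

lemma hardy_bound_antimono: "hardy_bound G p a K \<Longrightarrow> F \<subseteq> G \<Longrightarrow> hardy_bound F p a K"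
  by (auto simp: hardy_bound_def)

text \<open>Every function imposes a closed condition on the constant, so the infimum of the
  admissible constants is admissible. This gives \<open>LEAST\<close> its meaning as soon as one
  admissible constant is known.\<close>

lemma hardy_bound_Least:
  assumes p: "0 < p" and K0: "hardy_bound F p a K0"
  defines "L \<equiv> (LEAST K. hardy_bound F p a K)"
  shows "hardy_bound F p a L" and "\<And>K. hardy_bound F p a K \<Longrightarrow> L \<le> K"
proof -
  define S where "S = {K. hardy_bound F p a K}"
  have bdd: "bdd_below S" by (auto simp: S_def hardy_bound_def intro: bdd_belowI[of _ 0])
  have ne: "S \<noteq> {}" using K0 by (auto simp: S_def)
  have Inf_in: "Inf S \<in> T" if "closed T" "S \<subseteq> T" for T
    using closure_contains_Inf[OF ne bdd] closure_minimal[OF that(2,1)] by blast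
  have "hardy_bound F p a (Inf S)"
    unfolding hardy_bound_def
  proof (intro conjI ballI impI)
    show pos: "0 \<le> Inf S"
      using Inf_in[of "{0..}"] by (auto simp: S_def hardy_bound_def)
    fix f assume f: "f \<in> F" and fin: "weighted_pow p a f < \<infinity>"
    let ?w = "weighted_pow p a (\<lambda>t. hardy_op f t - f t)"
    obtain r where r: "weighted_pow p a f = ennreal r" "0 \<le> r"
      using fin by (cases "weighted_pow p a f") auto
    have le: "?w \<le> ennreal (K powr p * r)" if "K \<in> S" for K
      using that f fin r by (auto simp: S_def hardy_bound_def ennreal_mult')
    from le[of K0] K0 obtain v where v: "?w = ennreal v" "0 \<le> v"
      by (cases ?w) (auto simp: S_def top_unique)
    \<comment> \<open>Admissible \<open>K\<close> are nonnegative, so the absolute value changes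
      nothing there; it makes the condition continuous, hence closed, on the whole line.\<close>
    have "S \<subseteq> {K. v \<le> \<bar>K\<bar> powr p * r}"
    proof
      fix K assume "K \<in> S"
      moreover from this have "0 \<le> K" by (auto simp: S_def hardy_bound_def)
      ultimately show "K \<in> {K. v \<le> \<bar>K\<bar> powr p * r}"
        using le[of K] v r by simp
    qed
    moreover have "closed {K. v \<le> \<bar>K\<bar> powr p * r}"
      using p by (intro closed_Collect_le continuous_intros continuous_on_powr') auto
    ultimately have "v \<le> \<bar>Inf S\<bar> powr p * r" using Inf_in by blast
    then show "?w \<le> ennreal (Inf S powr p) * weighted_pow p a f"
      using pos v r by (simp add: ennreal_leI flip: ennreal_mult')
  qed
  moreover have low: "Inf S \<le> K" if "hardy_bound F p a K" for K
    using that bdd by (intro cInf_lower) (auto simp: S_def)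
  ultimately have "L = Inf S" unfolding L_def by (intro Least_equality) auto
  with \<open>hardy_bound F p a (Inf S)\<close> low show "hardy_bound F p a L"
    and "\<And>K. hardy_bound F p a K \<Longrightarrow> L \<le> K" by auto
qed

text \<open>The quotient \<open>f / g\<close> is nonnegative here, so the line is tested only for
  \<open>0 \<le> x\<close>. The root compensates for the power \<open>p\<close> in
  \<open>hardy_bound\<close>.\<close>

lemma hardy_bound_positive:
  assumes p: "1 \<le> p" and a: "a < p - 1" and M: "0 \<le> M"
    and ineq: "\<And>x. 0 \<le> x \<Longrightarrow> \<bar>x - 1\<bar> powr p + c * (x - (p - 1 - a) / p) \<le> M * \<bar>x\<bar> powr p"
  shows "hardy_bound positive_funs p a (M powr (1 / p))"
  unfolding hardy_bound_def
  using weighted_pow_sufficient[OF p a _ _ ineq] p M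
  by (auto simp: positive_funs_def powr_powr)

text \<open>With sign changes \<open>f / g\<close> may take any real value, so the line is tested on
  the whole axis; \<open>1 \<le> M\<close> covers the zeros of the mean.\<close>

lemma hardy_bound_half_line:
  assumes p: "1 < p" and a: "a < p - 1" and M: "1 \<le> M"
    and ineq: "\<And>x. \<bar>x - 1\<bar> powr p + c * (x - (p - 1 - a) / p) \<le> M * \<bar>x\<bar> powr p"
  shows "hardy_bound half_line_funs p a (M powr (1 / p))"
  unfolding hardy_bound_def
proof (intro conjI ballI impI)
  fix f assume f: "f \<in> half_line_funs" "weighted_pow p a f < \<infinity>"
  have "weighted_pow p a (\<lambda>t. hardy_op f t - f t) \<le> ennreal M * weighted_pow p a f"
    by (rule weighted_pow_sufficient[OF less_imp_le[OF p] a f ineq]) (use p M ineq in blast)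
  then show "weighted_pow p a (\<lambda>t. hardy_op f t - f t) \<le> ennreal ((M powr (1 / p)) powr p) * weighted_pow p a f"
    using p M by (simp add: powr_powr)
qed simp

section \<open>Elementary inequalities for powers\<close>

text \<open>Each summand \<open>z\<close> satisfies
  \<open>z powr q \<le> z * (x + y) powr (q - 1)\<close>; the two estimates are added.\<close>

lemma powr_add_superadditive:
  fixes x y q :: real
  assumes "1 \<le> q" "0 \<le> x" "0 \<le> y"
  shows "x powr q + y powr q \<le> (x + y) powr q"
proof -
  have *: "z powr q \<le> z * (x + y) powr (q - 1)" if "0 \<le> z" "z \<le> x + y" for z
  proof -
    have "z powr q = z * z powr (q - 1)"
      using that by (cases "z = 0") (auto simp: powr_diff)
    also have "\<dots> \<le> z * (x + y) powr (q - 1)"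
      using that assms by (intro mult_left_mono powr_mono2) auto
    finally show ?thesis .
  qed
  have "x powr q + y powr q \<le> (x + y) * (x + y) powr (q - 1)"
    using *[of x] *[of y] assms by (simp add: distrib_right)
  also have "\<dots> = (x + y) powr q"
    using assms by (cases "x + y = 0") (auto simp: powr_diff)
  finally show ?thesis .
qed

text \<open>The same splitting with the inequality reversed, since \<open>q - 1\<close> is at most
  0.\<close>

lemma powr_add_subadditive:
  fixes x y q :: real
  assumes "0 < q" "q \<le> 1" "0 \<le> x" "0 \<le> y"
  shows "(x + y) powr q \<le> x powr q + y powr q"
proof -
  have *: "z * (x + y) powr (q - 1) \<le> z powr q" if "0 \<le> z" "z \<le> x + y" for z
  proof (cases "z = 0")
    case False
    have "z * (x + y) powr (q - 1) \<le> z * z powr (q - 1)"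
      using that assms False by (intro mult_left_mono powr_mono2') auto
    also have "\<dots> = z powr q"
      using that False by (simp add: powr_diff)
    finally show ?thesis .
  qed (use assms in simp)
  have "(x + y) powr q = (x + y) * (x + y) powr (q - 1)"
    using assms by (cases "x + y = 0") (auto simp: powr_diff)
  also have "\<dots> \<le> x powr q + y powr q"
    using *[of x] *[of y] assms by (simp add: distrib_right)
  finally show ?thesis .
qed

text \<open>\<open>1 powr (p - 1)\<close> stays unevaluated to exhibit the defect of additivity of
  the power \<open>p - 1\<close>, whose sign is known on either side of
  \<open>p = 2\<close>.\<close>

lemma one_plus_powr_difference_derivative:
  fixes p u :: real
  assumes "0 < u"
  shows "((\<lambda>u. 1 + p * u + u powr p - (1 + u) powr p) has_real_derivative
    p * (1 powr (p - 1) + u powr (p - 1) - (1 + u) powr (p - 1))) (at u)"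
proof -
  have 1: "((\<lambda>u. u powr p) has_real_derivative p * u powr (p - 1)) (at u)"
    by (rule has_real_derivative_powr[OF assms])
  have 2: "((\<lambda>u. (1 + u) powr p) has_real_derivative p * (1 + u) powr (p - 1) * (0 + 1)) (at u)"
    using assms by (intro DERIV_chain2[OF has_real_derivative_powr] DERIV_add DERIV_const DERIV_ident) auto
  show ?thesis
    by (rule DERIV_cong[OF DERIV_diff[OF DERIV_add[OF DERIV_add[OF DERIV_const DERIV_cmult[OF DERIV_ident]] 1] 2]])
      (simp add: algebra_simps)
qed

text \<open>Equality at 0 and subadditivity of the power \<open>p - 1\<close> in the derivative.
  With \<open>u = - x\<close> this extends a line from \<open>0 \<le> x\<close> to negative
  \<open>x\<close>.\<close>

lemma one_plus_powr_le:
  fixes p u :: real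
  assumes "1 < p" "p \<le> 2" "0 \<le> u"
  shows "(1 + u) powr p \<le> 1 + p * u + u powr p"
proof -
  have "1 + p * 0 + 0 powr p - (1 + 0) powr p \<le> 1 + p * u + u powr p - (1 + u) powr p"
  proof (rule DERIV_nonneg_imp_increasing_open[OF assms(3)])
    show "\<exists>y. ((\<lambda>u. 1 + p * u + u powr p - (1 + u) powr p) has_real_derivative y) (at x) \<and> 0 \<le> y"
      if "0 < x" for x
    proof (intro exI conjI)
      show "0 \<le> p * (1 powr (p - 1) + x powr (p - 1) - (1 + x) powr (p - 1))"
        using powr_add_subadditive[of "p - 1" 1 x] assms that by simp
    qed (rule one_plus_powr_difference_derivative[OF that])
    show "continuous_on {0..u} (\<lambda>u. 1 + p * u + u powr p - (1 + u) powr p)"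
      using assms by (intro continuous_intros continuous_on_powr') auto
  qed
  then show ?thesis by simp
qed

text \<open>Superadditivity of the power \<open>p - 1\<close> reverses the monotonicity. With
  \<open>u = x - 1\<close> this carries estimates beyond \<open>x = 1\<close>.\<close>

lemma one_plus_powr_ge:
  fixes p u :: real
  assumes "2 \<le> p" "0 \<le> u"
  shows "1 + p * u + u powr p \<le> (1 + u) powr p"
proof -
  have "1 + p * 0 + 0 powr p - (1 + 0) powr p \<ge> 1 + p * u + u powr p - (1 + u) powr p"
  proof (rule DERIV_nonpos_imp_decreasing_open[OF assms(2)])
    show "\<exists>y. ((\<lambda>u. 1 + p * u + u powr p - (1 + u) powr p) has_real_derivative y) (at x) \<and> y \<le> 0"
      if "0 < x" for x
    proof (intro exI conjI)
      show "p * (1 powr (p - 1) + x powr (p - 1) - (1 + x) powr (p - 1)) \<le> 0"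
        using powr_add_superadditive[of "p - 1" 1 x] assms that by (intro mult_nonneg_nonpos) auto
    qed (rule one_plus_powr_difference_derivative[OF that])
    show "continuous_on {0..u} (\<lambda>u. 1 + p * u + u powr p - (1 + u) powr p)"
      using assms by (intro continuous_intros continuous_on_powr') auto
  qed
  then show ?thesis by simp
qed

text \<open>Equality at 0; the derivative of the difference is nonpositive by superadditivity for
  two numbers with sum 1.\<close>

lemma powr_minus_reflected_powr_le:
  fixes p u :: real
  assumes "2 \<le> p" "0 \<le> u" "u \<le> 1"
  shows "u powr p - (1 - u) powr p \<le> p * u - 1"
proof -
  let ?f = "\<lambda>u. u powr p - (1 - u) powr p - p * u"
  have "?f 0 \<ge> ?f u"
  proof (rule DERIV_nonpos_imp_decreasing_open[OF assms(2)])
    fix x assume x: "0 < x" "x < u"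
    have 1: "((\<lambda>u. u powr p) has_real_derivative p * x powr (p - 1)) (at x)"
      by (rule has_real_derivative_powr[OF x(1)])
    have 2: "((\<lambda>u. (1 - u) powr p) has_real_derivative p * (1 - x) powr (p - 1) * (0 - 1)) (at x)"
      using assms x by (intro DERIV_chain2[OF has_real_derivative_powr] DERIV_diff DERIV_const DERIV_ident) auto
    have "(?f has_real_derivative p * (x powr (p - 1) + (1 - x) powr (p - 1) - 1)) (at x)"
      by (rule DERIV_cong[OF DERIV_diff[OF DERIV_diff[OF 1 2] DERIV_cmult[OF DERIV_ident]]])
        (simp add: algebra_simps)
    moreover have "p * (x powr (p - 1) + (1 - x) powr (p - 1) - 1) \<le> 0"
      using powr_add_superadditive[of "p - 1" x "1 - x"] assms x
      by (intro mult_nonneg_nonpos) auto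
    ultimately show "\<exists>y. (?f has_real_derivative y) (at x) \<and> y \<le> 0" by blast
  next
    show "continuous_on {0..u} ?f"
      using assms by (intro continuous_intros continuous_on_powr') auto
  qed
  then show ?thesis using assms by simp
qed

lemma powr_le_linear:
  fixes p x :: real
  assumes "1 \<le> p" "0 \<le> x" "x \<le> 1"
  shows "x powr p \<le> x"
  using powr_mono'[of 1 p x] assms by simp

text \<open>Bernoulli's inequality for exponents at most 1, from the weighted arithmetic-geometric
  mean inequality for \<open>1 - x\<close> and 1.\<close>

lemma one_minus_powr_le:
  fixes q x :: real
  assumes "0 < q" "q \<le> 1" "0 \<le> x" "x \<le> 1"
  shows "(1 - x) powr q \<le> 1 - q * x"
proof (cases "x = 1")
  case False
  then show ?thesis
    using Youngs_inequality_0[of q "1 - q" "1 - x" 1] assms by (simp add: algebra_simps)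
qed (use assms in simp)

section \<open>Supporting lines and first estimates for the constants\<close>

text \<open>
  The slope produced is the least one, whence its comparison with any \<open>u\<close> that works to the left of \<open>b\<close>.
\<close>

lemma supporting_slope:
  fixes p a M :: real
  defines "b \<equiv> (p - 1 - a) / p"
  assumes p: "1 \<le> p" and a: "a < p - 1"
    and D: "\<alpha>0 \<in> D" "\<alpha>0 < b" "b < \<beta>0" "{b<..\<beta>0} \<subseteq> D"
    and k: "\<And>\<alpha> \<beta>. \<alpha> \<in> D \<Longrightarrow> \<beta> \<in> D \<Longrightarrow> \<alpha> < b \<Longrightarrow> b < \<beta> \<Longrightarrow> k_fun p a \<alpha> \<beta> \<le> M"
  obtains c where "\<And>x. x \<in> D \<Longrightarrow> \<bar>x - 1\<bar> powr p + c * (x - b) \<le> M * \<bar>x\<bar> powr p"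
    and "\<And>u. (\<And>\<alpha>. \<alpha> \<in> D \<Longrightarrow> \<alpha> < b \<Longrightarrow> \<bar>\<alpha> - 1\<bar> powr p - M * \<bar>\<alpha>\<bar> powr p \<le> u * (b - \<alpha>)) \<Longrightarrow> c \<le> u"
proof -
  have b: "0 < b" using p a by (simp add: b_def)
  define h where "h x = M * \<bar>x\<bar> powr p - \<bar>x - 1\<bar> powr p" for x
  \<comment> \<open>With denominators cleared, \<open>k_fun p a \<alpha> \<beta> \<le> M\<close>
    compares the slopes of the segments from \<open>(b, 0)\<close> to the graph of \<open>h\<close>
    at \<open>\<alpha>\<close> and at \<open>\<beta>\<close>.\<close>
  have key: "- h \<alpha> / (b - \<alpha>) \<le> h \<beta> / (\<beta> - b)"
    if \<alpha>: "\<alpha> \<in> D" "\<alpha> < b" and \<beta>: "\<beta> \<in> D" "b < \<beta>" for \<alpha> \<beta>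
  proof -
    have "0 < (\<beta> - b) * \<bar>\<alpha>\<bar> powr p + (b - \<alpha>) * \<bar>\<beta>\<bar> powr p"
      using \<alpha> \<beta> b by (intro add_nonneg_pos) auto
    then have "(\<beta> - b) * \<bar>\<alpha> - 1\<bar> powr p + (b - \<alpha>) * \<bar>\<beta> - 1\<bar> powr p
      \<le> M * ((\<beta> - b) * \<bar>\<alpha>\<bar> powr p + (b - \<alpha>) * \<bar>\<beta>\<bar> powr p)"
      using k[OF \<alpha>(1) \<beta>(1) \<alpha>(2) \<beta>(2)] unfolding k_fun_def b_def[symmetric] by (simp add: divide_le_eq)
    then have "- h \<alpha> * (\<beta> - b) \<le> h \<beta> * (b - \<alpha>)" by (simp add: h_def algebra_simps)
    then show ?thesis using \<alpha> \<beta> by (simp add: divide_le_eq le_divide_eq field_simps)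
  qed
  define S where "S = (\<lambda>\<alpha>. - h \<alpha> / (b - \<alpha>)) ` (D \<inter> {..<b})"
  define c where "c = Sup S"
  have ne: "S \<noteq> {}" using D by (auto simp: S_def)
  have \<beta>0: "\<beta>0 \<in> D" using D by auto
  have bdd: "bdd_above S" using key[OF _ _ \<beta>0 D(3)] by (auto simp: S_def intro!: bdd_aboveI2)
  have right: "c * (x - b) \<le> h x" if "x \<in> D" "b < x" for x
  proof -
    have "c \<le> h x / (x - b)"
      unfolding c_def by (rule cSup_least[OF ne]) (use key[OF _ _ that] in \<open>auto simp: S_def\<close>)
    then show ?thesis using that by (simp add: le_divide_eq)
  qed
  have left: "c * (x - b) \<le> h x" if "x \<in> D" "x < b" for x
  proof -
    have "- h x / (b - x) \<le> c"
      unfolding c_def by (rule cSup_upper[OF _ bdd]) (use that in \<open>auto simp: S_def\<close>)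
    then have "- h x / (b - x) * (b - x) \<le> c * (b - x)"
      using that by (intro mult_right_mono) auto
    then have "- h x \<le> c * (b - x)" using that by simp
    then show ?thesis by (simp add: algebra_simps)
  qed
  \<comment> \<open>At \<open>b\<close> itself there is no slope; the inequality is recovered by
    continuity from the right, using the interval \<open>{b<..\<beta>0}\<close> in
    \<open>D\<close>.\<close>
  have mid: "0 \<le> h b"
  proof (rule tendsto_le[of "at_right b"])
    have "continuous_on UNIV h"
      unfolding h_def using p by (intro continuous_intros continuous_on_powr') auto
    then show "(h \<longlongrightarrow> h b) (at_right b)"
      by (meson UNIV_I continuous_on_def tendsto_within_subset subset_UNIV)
    show "((\<lambda>x. c * (x - b)) \<longlongrightarrow> 0) (at_right b)"
      by (auto intro!: tendsto_eq_intros)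
    have "c * (x - b) \<le> h x" if "b < x" "x < \<beta>0" for x
      using right[of x] subsetD[OF D(4), of x] that by auto
    then show "\<forall>\<^sub>F x in at_right b. c * (x - b) \<le> h x"
      unfolding eventually_at_right[OF D(3)] using D(3) by blast
  qed auto
  show thesis
  proof (rule that[of c])
    show "\<bar>x - 1\<bar> powr p + c * (x - b) \<le> M * \<bar>x\<bar> powr p" if "x \<in> D" for x
      using right[OF that] left[OF that] mid by (cases x b rule: linorder_cases) (auto simp: h_def)
    show "c \<le> u" if u: "\<And>\<alpha>. \<alpha> \<in> D \<Longrightarrow> \<alpha> < b \<Longrightarrow> \<bar>\<alpha> - 1\<bar> powr p - M * \<bar>\<alpha>\<bar> powr p \<le> u * (b - \<alpha>)" for u
      unfolding c_def using u
      by (intro cSup_least[OF ne]) (auto simp: S_def h_def divide_le_eq)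
  qed
qed

text \<open>Dropping the positive term \<open>\<beta> - b\<close> from the numerator leaves
  \<open>(1 - inverse \<beta>) powr p\<close>, which tends to 1 as \<open>\<beta>\<close>
  grows.\<close>

lemma one_le_of_k_fun_le:
  fixes p a M :: real
  assumes p: "1 \<le> p" and a: "a < p - 1"
    and k: "\<And>\<beta>. (p - 1 - a) / p < \<beta> \<Longrightarrow> k_fun p a 0 \<beta> \<le> M"
  shows "1 \<le> M"
proof -
  define b where "b = (p - 1 - a) / p"
  have b: "0 < b" using p a by (simp add: b_def)
  have "(1 - inverse \<beta>) powr p \<le> M" if \<beta>: "max b 1 < \<beta>" for \<beta>
  proof -
    have "(1 - inverse \<beta>) powr p = (\<beta> - 1) powr p / \<beta> powr p"
      using \<beta> by (simp add: field_simps flip: powr_divide)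
    also have "\<dots> = b * (\<beta> - 1) powr p / (b * \<beta> powr p)"
      using b by simp
    also have "\<dots> \<le> ((\<beta> - b) + b * (\<beta> - 1) powr p) / (b * \<beta> powr p)"
      using \<beta> b by (intro divide_right_mono) auto
    also have "\<dots> = k_fun p a 0 \<beta>"
      using \<beta> p by (simp add: k_fun_def flip: b_def)
    finally show ?thesis using k[of \<beta>] \<beta> by (simp add: b_def)
  qed
  moreover have "((\<lambda>\<beta>::real. (1 - inverse \<beta>) powr p) \<longlongrightarrow> (1 - 0) powr p) at_top"
    by (intro tendsto_intros tendsto_inverse_0_at_top filterlim_ident) auto
  moreover from calculation have "\<forall>\<^sub>F \<beta> in at_top. (1 - inverse \<beta>) powr p \<le> M"
    unfolding eventually_at_top_dense by blast
  ultimately have "(1 - 0) powr p \<le> M"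
    by (intro tendsto_upperbound[of _ _ at_top]) auto
  then show ?thesis by simp
qed

text \<open>Provides one admissible constant for positive functions. A steep slope outweighs
  \<open>\<bar>x - 1\<bar> powr p\<close> up to \<open>b / 2\<close>; beyond that point
  \<open>1 \<le> 2 / b * x\<close> absorbs everything into \<open>x powr p\<close>.\<close>

lemma crude_positive_slope:
  fixes p b :: real
  assumes p: "1 \<le> p" and b: "0 < b"
  obtains c M where "0 \<le> M" "\<And>x. 0 \<le> x \<Longrightarrow> \<bar>x - 1\<bar> powr p + c * (x - b) \<le> M * \<bar>x\<bar> powr p"
proof -
  define c where "c = 2 * (1 + b) powr p / b"
  define M where "M = (1 + 2 / b) powr p + c * (b / 2) * (2 / b) powr p"
  have c: "0 \<le> c" using b by (simp add: c_def)
  have M: "0 \<le> M" using b c by (simp add: M_def)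
  have "\<bar>x - 1\<bar> powr p + c * (x - b) \<le> M * \<bar>x\<bar> powr p" if x: "0 \<le> x" for x
  proof (cases "x \<le> b / 2")
    case True
    have "\<bar>x - 1\<bar> powr p \<le> (1 + b) powr p"
      using p b x True by (intro powr_mono2) auto
    moreover have "c * (x - b) \<le> c * (- (b / 2))"
      using True c by (intro mult_left_mono) auto
    moreover have "c * (- (b / 2)) = - ((1 + b) powr p)" using b by (simp add: c_def)
    ultimately have "\<bar>x - 1\<bar> powr p + c * (x - b) \<le> 0" by simp
    also have "0 \<le> M * \<bar>x\<bar> powr p" using M by simp
    finally show ?thesis .
  next
    case False
    have 1: "1 \<le> 2 / b * x" using False b by (simp add: field_simps)
    have "\<bar>x - 1\<bar> \<le> (1 + 2 / b) * x" using 1 x by (simp add: distrib_right abs_le_iff)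
    then have "\<bar>x - 1\<bar> powr p \<le> ((1 + 2 / b) * x) powr p"
      using p by (intro powr_mono2) auto
    also have "\<dots> = (1 + 2 / b) powr p * x powr p"
      using b x by (simp add: powr_mult)
    finally have A: "\<bar>x - 1\<bar> powr p \<le> (1 + 2 / b) powr p * x powr p" .
    have "x = b / 2 * (2 / b * x) powr 1" using 1 b by simp
    also have "\<dots> \<le> b / 2 * (2 / b * x) powr p"
      using 1 b p by (intro mult_left_mono powr_mono) auto
    also have "\<dots> = b / 2 * (2 / b) powr p * x powr p"
      using b x by (subst powr_mult) auto
    finally have "c * x \<le> c * (b / 2 * (2 / b) powr p * x powr p)"
      using c by (intro mult_left_mono) auto
    moreover have "c * (x - b) \<le> c * x" using c b by (intro mult_left_mono) auto
    ultimately show ?thesis using A x by (simp add: M_def algebra_simps)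
  qed
  with M that show thesis by blast
qed

section \<open>The equation for \<open>\<beta>\<^sub>1\<close> and the maximum of the tangent
  quotient\<close>

text \<open>
  The least \<open>M\<close> for which the line through \<open>(b, 0)\<close> of slope \<open>1 / b\<close>, that is, through \<open>(0, -1)\<close>, fits
  below at \<open>x\<close>. For \<open>x > 1\<close> its derivative has the sign of the left-hand side of the equation for \<open>\<beta>\<^sub>1\<close>.
\<close>

definition tangent_quotient :: "real \<Rightarrow> real \<Rightarrow> real \<Rightarrow> real" where
  "tangent_quotient p b x = (\<bar>x - 1\<bar> powr p + x / b - 1) / x powr p"

lemma tangent_quotient_derivative:
  assumes "1 < p" "0 < x"
  shows "(tangent_quotient p b has_real_derivative
    x powr (p - 1) * (x * (p * sgn (x - 1) * \<bar>x - 1\<bar> powr (p - 1) + 1 / b)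
       - p * (\<bar>x - 1\<bar> powr p + x / b - 1)) / (x powr p * x powr p)) (at x)"
proof -
  have "((\<lambda>x. \<bar>x - 1\<bar> powr p) has_real_derivative p * sgn (x - 1) * \<bar>x - 1\<bar> powr (p - 1) * (1 - 0)) (at x)"
    by (rule DERIV_chain2[OF has_real_derivative_abs_powr[OF assms(1)] DERIV_diff[OF DERIV_ident DERIV_const]])
  then have 1: "((\<lambda>x. \<bar>x - 1\<bar> powr p + x / b - 1) has_real_derivative
      p * sgn (x - 1) * \<bar>x - 1\<bar> powr (p - 1) * (1 - 0) + 1 / b - 0) (at x)"
    by (intro DERIV_diff DERIV_add DERIV_cdivide DERIV_ident DERIV_const)
  have "x powr p = x * x powr (p - 1)" using assms by (simp add: powr_diff)
  then show ?thesis
    unfolding tangent_quotient_def[abs_def] using assms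
    by (intro DERIV_cong[OF DERIV_divide[OF 1 has_real_derivative_powr[OF assms(2)]]])
      (simp_all add: algebra_simps)
qed

lemma continuous_on_tangent_quotient:
  assumes "1 < p" "S \<subseteq> {0<..}"
  shows "continuous_on S (tangent_quotient p b)"
  using assms by (intro continuous_at_imp_continuous_on ballI DERIV_isCont[OF tangent_quotient_derivative]) auto

text \<open>Monotonicity of the tangent quotient depends on the sign of this expression on both
  sides of its root, not only on the equation \<open>beta1_eq\<close>.\<close>

definition beta1_lhs :: "real \<Rightarrow> real \<Rightarrow> real \<Rightarrow> real" where
  "beta1_lhs p a \<beta> =
    (p - 1 - a) * \<bar>1 - \<beta>\<bar> powr (p - 2) * (\<beta> - 1) - (p - 1) * \<beta> + p - 1 - a"

text \<open>With \<open>y = x - 1\<close> the expression is \<open>y * (H y - (p - 1))\<close>.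
  \<open>H\<close> decreases strictly because \<open>p - 2\<close> and \<open>a\<close> are
  negative, exceeds \<open>p - 1\<close> at \<open>l\<close> and tends to 0, so it crosses
  \<open>p - 1\<close> exactly once.\<close>

lemma beta1_root:
  assumes p: "1 < p" "p < 2" and a: "a \<le> p - 2"
  obtains \<beta> where "1 < \<beta>" "beta1_lhs p a \<beta> = 0"
    "\<And>x. 1 < x \<Longrightarrow> x < \<beta> \<Longrightarrow> 0 < beta1_lhs p a x"
    "\<And>x. \<beta> < x \<Longrightarrow> beta1_lhs p a x < 0"
proof -
  define H where "H y = (p - 1 - a) * y powr (p - 2) - a / y" for y
  have lhs: "beta1_lhs p a x = (x - 1) * (H (x - 1) - (p - 1))" if "1 < x" for x
  proof -
    define y where "y = x - 1"
    have "0 < y" "x = 1 + y" using that by (auto simp: y_def)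
    then show ?thesis by (simp add: beta1_lhs_def H_def algebra_simps)
  qed
  have H_less: "H y < H x" if "0 < x" "x < y" for x y
  proof -
    have "(p - 1 - a) * y powr (p - 2) < (p - 1 - a) * x powr (p - 2)"
      using that p a by (intro mult_strict_left_mono powr_less_mono2_neg) auto
    moreover have "- a / y \<le> - a / x"
      using that p a by (intro divide_left_mono) auto
    ultimately show ?thesis by (simp add: H_def)
  qed
  \<comment> \<open>At this point the term \<open>- a / l\<close> alone equals \<open>p - 1\<close>,
    and the other term of \<open>H\<close> is positive.\<close>
  define l where "l = - a / (p - 1)"
  have l: "0 < l" using p a by (simp add: l_def divide_neg_pos)
  have Hl: "p - 1 < H l"
  proof -
    have "- a / l = p - 1" using p a by (simp add: l_def)
    moreover have "0 < (p - 1 - a) * l powr (p - 2)" using l p a by simp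
    ultimately show ?thesis by (simp add: H_def)
  qed
  have "(H \<longlongrightarrow> (p - 1 - a) * 0 - 0) at_top"
    unfolding H_def using p
    by (intro tendsto_intros tendsto_neg_powr filterlim_ident tendsto_divide_0[OF tendsto_const]
        filterlim_at_top_imp_at_infinity) auto
  then have "\<forall>\<^sub>F y in at_top. H y < p - 1"
    using p by (intro order_tendstoD(2)) auto
  then have "\<forall>\<^sub>F y in at_top. l < y \<and> H y < p - 1"
    by (intro eventually_conj eventually_gt_at_top)
  then obtain u where u: "l < u" "H u < p - 1"
    by (auto dest!: eventually_happens)
  have "\<exists>y\<ge>l. y \<le> u \<and> H y = p - 1"
  proof (rule IVT2')
    show "continuous_on {l..u} H"
      unfolding H_def using l by (intro continuous_intros) auto
  qed (use u Hl in auto)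
  then obtain y where y: "l \<le> y" "H y = p - 1" by blast
  show thesis
  proof (rule that[of "y + 1"])
    show "1 < y + 1" using y l by simp
    then show "beta1_lhs p a (y + 1) = 0" by (simp add: lhs y)
    show "0 < beta1_lhs p a x" if "1 < x" "x < y + 1" for x
      using H_less[of "x - 1" y] that by (simp add: lhs y(2)[symmetric])
    show "beta1_lhs p a x < 0" if "y + 1 < x" for x
    proof -
      have "0 < y" "1 < x" using that y l by auto
      then show ?thesis
        using H_less[of y "x - 1"] that by (subst lhs) (auto intro!: mult_pos_neg simp: y(2))
    qed
  qed
qed

text \<open>The quotient rises up to \<open>\<beta>\<close> and falls afterwards: beyond 1 its
  derivative has the sign of \<open>beta1_lhs\<close>, and below 1 it is nonnegative by Bernoulli's
  inequality.\<close>

lemma tangent_quotient_le: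
  fixes p a :: real
  defines "b \<equiv> (p - 1 - a) / p"
  assumes p: "1 < p" "p < 2" and a: "a \<le> p - 2" and \<beta>: "1 < \<beta>"
    and pos: "\<And>x. 1 < x \<Longrightarrow> x < \<beta> \<Longrightarrow> 0 < beta1_lhs p a x"
    and neg: "\<And>x. \<beta> < x \<Longrightarrow> beta1_lhs p a x < 0"
    and x: "0 < x"
  shows "tangent_quotient p b x \<le> tangent_quotient p b \<beta>"
proof -
  have b: "0 < b" "p * b = p - 1 - a" using p a by (auto simp: b_def)
  \<comment> \<open>The hypothesis \<open>a \<le> p - 2\<close> says precisely
    \<open>1 \<le> p * b\<close>.\<close>
  have inv_b: "1 / b \<le> p" using b a by (simp add: divide_le_eq)
  define n where "n x = x * (p * sgn (x - 1) * \<bar>x - 1\<bar> powr (p - 1) + 1 / b)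
       - p * (\<bar>x - 1\<bar> powr p + x / b - 1)" for x
  define d where "d x = x powr (p - 1) * n x / (x powr p * x powr p)" for x
  have deriv: "(tangent_quotient p b has_real_derivative d x) (at x)" if "0 < x" for x
    unfolding d_def n_def by (rule tangent_quotient_derivative[OF p(1) that])
  have n_gt: "n x = beta1_lhs p a x / b" if "1 < x" for x
  proof -
    define y where "y = x - 1"
    have y: "0 < y" "x = 1 + y" using that by (auto simp: y_def)
    have e: "y powr p = y * y powr (p - 1)" "y powr (p - 2) * y = y powr (p - 1)"
      using y by (auto simp: powr_diff power2_eq_square powr_numeral)
    have "n x = p * y powr (p - 1) + p - (p - 1) * x / b"
      using y by (simp add: n_def e(1) algebra_simps diff_divide_distrib)
    also have "\<dots> = (p * b * y powr (p - 1) - (p - 1) * x + p * b) / b"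
      using b by (simp add: field_simps)
    also have "p * b * y powr (p - 1) - (p - 1) * x + p * b = beta1_lhs p a x"
      unfolding beta1_lhs_def b(2) e(2)[symmetric] using y by (simp add: algebra_simps)
    finally show ?thesis .
  qed
  \<comment> \<open>The numerator collapses to \<open>p * (1 - w) - (p - 1) * x * (1 / b)\<close>;
    \<open>1 / b \<le> p\<close> reduces its sign to Bernoulli's inequality with exponent
    \<open>p - 1\<close>.\<close>
  have n_lt: "0 \<le> n x" if "0 < x" "x < 1" for x
  proof -
    define z where "z = 1 - x"
    have z: "0 < z" "x = 1 - z" using that by (auto simp: z_def)
    define w where "w = z powr (p - 1)"
    have e: "z powr p = z * w" "z powr (p - 1) = w" "\<bar>x - 1\<bar> = z" "sgn (x - 1) = - 1"
      using z by (simp_all add: w_def powr_diff)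
    have "n x = x * (1 / b - p * w) - p * (z * w + x / b - 1)"
      unfolding n_def e by simp
    also have "\<dots> = p * (1 - w) - (p - 1) * x * (1 / b)"
      unfolding z(2) by (simp add: algebra_simps diff_divide_distrib add_divide_distrib)
    finally have "n x = p * (1 - z powr (p - 1)) - (p - 1) * x * (1 / b)"
      unfolding w_def .
    moreover have "(p - 1) * x * (1 / b) \<le> (p - 1) * x * p"
      using inv_b p that by (intro mult_left_mono) auto
    moreover have "p * ((p - 1) * x) \<le> p * (1 - z powr (p - 1))"
      using one_minus_powr_le[of "p - 1" x] p that by (intro mult_left_mono) (auto simp: z_def)
    ultimately show ?thesis by (simp add: mult_ac)
  qed
  have d_nonneg: "0 \<le> d x" if "0 \<le> n x" for x
    unfolding d_def using that by (intro divide_nonneg_nonneg mult_nonneg_nonneg) auto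
  have d_nonpos: "d x \<le> 0" if "n x \<le> 0" for x
    unfolding d_def using that by (intro divide_nonpos_nonneg mult_nonneg_nonpos) auto
  have incr1: "tangent_quotient p b x \<le> tangent_quotient p b 1" if "0 < x" "x \<le> 1" for x
  proof (rule DERIV_nonneg_imp_increasing_open[OF that(2)])
    show "\<exists>y. (tangent_quotient p b has_real_derivative y) (at z) \<and> 0 \<le> y" if "x < z" "z < 1" for z
      using deriv[of z] d_nonneg[OF n_lt[of z]] \<open>0 < x\<close> that by (intro exI[of _ "d z"]) auto
  qed (use that p in \<open>auto intro!: continuous_on_tangent_quotient\<close>)
  have incr2: "tangent_quotient p b x \<le> tangent_quotient p b \<beta>" if "1 \<le> x" "x \<le> \<beta>" for x
  proof (rule DERIV_nonneg_imp_increasing_open[OF that(2)])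
    show "\<exists>y. (tangent_quotient p b has_real_derivative y) (at z) \<and> 0 \<le> y" if "x < z" "z < \<beta>" for z
      using deriv[of z] d_nonneg[of z] pos[of z] n_gt[of z] b(1) \<open>1 \<le> x\<close> that
      by (intro exI[of _ "d z"]) auto
  qed (use that p in \<open>auto intro!: continuous_on_tangent_quotient\<close>)
  have decr: "tangent_quotient p b x \<le> tangent_quotient p b \<beta>" if "\<beta> \<le> x" for x
  proof (rule DERIV_nonpos_imp_decreasing_open[OF that])
    show "\<exists>y. (tangent_quotient p b has_real_derivative y) (at z) \<and> y \<le> 0" if "\<beta> < z" "z < x" for z
      using deriv[of z] d_nonpos[of z] neg[of z] n_gt[of z] b(1) \<beta> that
      by (intro exI[of _ "d z"]) (auto simp: divide_le_0_iff)
  qed (use that p \<beta> in \<open>auto intro!: continuous_on_tangent_quotient\<close>)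
  show ?thesis
    using incr1[of x] incr2[of 1] incr2[of x] decr[of x] x \<beta> by linarith
qed

lemma beta1_eq_iff: "beta1_eq p a \<beta> \<longleftrightarrow> beta1_lhs p a \<beta> = 0"
  by (simp add: beta1_eq_def beta1_lhs_def)

section \<open>The constant for positive functions in the four ranges of the parameters\<close>

theorem theorem2p3:
  fixes p a :: real
  assumes "1 \<le> p" and "a < p - 1"
  shows "(p = 1 \<longrightarrow> B_const p a powr p = (1 - a) / (- a)) \<and>
    (1 < p \<and> p < 2 \<and> p - 2 < a \<longrightarrow> B_const p a powr p = C_const p a powr p) \<and>
    (1 < p \<and> p < 2 \<and> a \<le> p - 2 \<longrightarrow>
       (\<exists>!\<beta>. 1 < \<beta> \<and> beta1_eq p a \<beta>) \<and> B_const p a powr p = k_fun p a 0 (beta1 p a)) \<and>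
    (2 \<le> p \<longrightarrow>
       B_const p a powr p = (if -1 < a then max (A_const p a powr p) 1 else 1))"
proof -
  note p = \<open>1 \<le> p\<close> and a = \<open>a < p - 1\<close>
  define b where "b = (p - 1 - a) / p"
  define B where "B = B_const p a"
  have b: "0 < b" "p * b = p - 1 - a" using p a by (auto simp: b_def)
  obtain c0 M0 where "0 \<le> M0" "\<And>x. 0 \<le> x \<Longrightarrow> \<bar>x - 1\<bar> powr p + c0 * (x - b) \<le> M0 * \<bar>x\<bar> powr p"
    by (rule crude_positive_slope[OF p b(1)]) blast
  then have adm: "hardy_bound positive_funs p a (M0 powr (1 / p))"
    unfolding b_def by (rule hardy_bound_positive[OF p a])
  have B: "hardy_bound positive_funs p a B"
    and B_least: "\<And>K. hardy_bound positive_funs p a K \<Longrightarrow> B \<le> K"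
    unfolding B_def B_const_def using hardy_bound_Least[OF _ adm] p by auto
  have B0: "0 \<le> B" using B by (simp add: hardy_bound_def)
  have k_le_B: "k_fun p a \<alpha> \<beta> \<le> B powr p" if "0 \<le> \<alpha>" "\<alpha> < b" "b < \<beta>" for \<alpha> \<beta>
    using that b by (intro k_fun_le_hardy_bound[OF p a _ _ two_powers_positive_funs B]) (auto simp: b_def)
  have B_ge_1: "1 \<le> B powr p"
    using k_le_B[OF order_refl b(1)] by (intro one_le_of_k_fun_le[OF p a]) (auto simp: b_def)
  have B_le: "B powr p \<le> M"
    if "0 \<le> M" "\<And>x. 0 \<le> x \<Longrightarrow> \<bar>x - 1\<bar> powr p + c * (x - b) \<le> M * \<bar>x\<bar> powr p" for c M
  proof -
    have "B \<le> M powr (1 / p)"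
      using that by (intro B_least hardy_bound_positive[OF p a, of M c]) (auto simp: b_def)
    then have "B powr p \<le> (M powr (1 / p)) powr p"
      using B0 p by (intro powr_mono2) auto
    then show ?thesis using that p by (simp add: powr_powr)
  qed

  \<comment> \<open>The line of slope \<open>1 / b\<close> passes through \<open>(0, -1)\<close>,
    and \<open>\<bar>x - 1\<bar> \<le> x + 1\<close> gives the upper bound. The lower bound is the
    limit of \<open>k_fun p a 0 \<beta>\<close> as \<open>\<beta>\<close> tends to infinity.\<close>
  have case1: "B powr p = (1 - a) / (- a)" if p1: "p = 1"
  proof (rule antisym)
    have ba: "b = - a" "a < 0" using b p1 a by auto
    have eq: "(1 - a) / (- a) = 1 + 1 / b" using ba by (simp add: field_simps)
    show "B powr p \<le> (1 - a) / (- a)"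
    proof (rule B_le[of _ "1 / b"])
      show "0 \<le> (1 - a) / (- a)" unfolding eq using b by simp
      show "\<bar>x - 1\<bar> powr p + 1 / b * (x - b) \<le> (1 - a) / (- a) * \<bar>x\<bar> powr p" if "0 \<le> x" for x
      proof -
        have "1 / b * (x - b) = x / b - 1" using b by (simp add: field_simps)
        moreover have "(1 + 1 / b) * x = x + x / b" by (simp add: distrib_right)
        ultimately show ?thesis using that unfolding eq by (simp add: p1)
      qed
    qed
    have lower: "1 + 1 / b - 2 * inverse \<beta> \<le> B powr p" if \<beta>: "max b 1 < \<beta>" for \<beta>
    proof -
      have "1 + 1 / b - 2 * inverse \<beta> = k_fun p a 0 \<beta>"
        unfolding k_fun_def b_def[symmetric] using \<beta> b by (simp add: p1 field_simps)
      then show ?thesis using k_le_B[of 0 \<beta>] \<beta> b by simp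
    qed
    have "((\<lambda>\<beta>. 1 + 1 / b - 2 * inverse \<beta>) \<longlongrightarrow> 1 + 1 / b - 2 * 0) at_top"
      by (intro tendsto_intros tendsto_inverse_0_at_top filterlim_ident)
    moreover have "\<forall>\<^sub>F \<beta> in at_top. 1 + 1 / b - 2 * inverse \<beta> \<le> B powr p"
      unfolding eventually_at_top_dense using lower by blast
    ultimately have "1 + 1 / b - 2 * 0 \<le> B powr p"
      by (intro tendsto_upperbound[of _ _ at_top]) auto
    then show "(1 - a) / (- a) \<le> B powr p" unfolding eq by simp
  qed

  \<comment> \<open>The supporting line found for \<open>0 \<le> x\<close> also works for negative
    \<open>x\<close>, so \<open>B\<close> is admissible for all measurable functions.\<close>
  have case2: "B = C_const p a" if p12: "1 < p" "p < 2" and a2: "p - 2 < a"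
  proof -
    obtain c where c: "\<And>x. 0 \<le> x \<Longrightarrow> \<bar>x - 1\<bar> powr p + c * (x - b) \<le> B powr p * \<bar>x\<bar> powr p"
    proof (rule supporting_slope[OF p a, of 0 "{0..}" "b + 1" "B powr p"])
      show "k_fun p a \<alpha> \<beta> \<le> B powr p"
        if "\<alpha> \<in> {0..}" "\<beta> \<in> {0..}" "\<alpha> < (p - 1 - a) / p" "(p - 1 - a) / p < \<beta>" for \<alpha> \<beta>
        using k_le_B[of \<alpha> \<beta>] that by (simp add: b_def)
    qed (use b in \<open>auto simp: b_def\<close>)
    have cb: "1 \<le> c * b" using c[of 0] by simp
    \<comment> \<open>Since \<open>p - 2 < a\<close> means \<open>p * b < 1\<close>, the value at 0,
      which gives \<open>1 \<le> c * b\<close>, makes the slope at least \<open>p\<close>.\<close>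
    have "p * b < 1" using b a2 by simp
    have "p * b \<le> c * b" using \<open>p * b < 1\<close> cb by linarith
    then have pc: "p \<le> c" by (rule mult_right_le_imp_le[OF _ b(1)])
    have c_neg: "\<bar>x - 1\<bar> powr p + c * (x - b) \<le> B powr p * \<bar>x\<bar> powr p" if "x < 0" for x
    proof -
      have "(1 + (- x)) powr p \<le> 1 + p * (- x) + (- x) powr p"
        using that p12 by (intro one_plus_powr_le) auto
      moreover have "(- x) powr p \<le> B powr p * (- x) powr p"
        using mult_right_mono[OF B_ge_1, of "(- x) powr p"] by simp
      moreover have "p * (- x) \<le> c * (- x)" using pc that by (intro mult_right_mono) auto
      moreover have "\<bar>x - 1\<bar> = 1 + (- x)" "\<bar>x\<bar> = - x" using that by auto
      ultimately show ?thesis using cb by (simp add: algebra_simps)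
    qed
    have "\<bar>x - 1\<bar> powr p + c * (x - b) \<le> B powr p * \<bar>x\<bar> powr p" for x
      using c[of x] c_neg[of x] by linarith
    then have "hardy_bound half_line_funs p a ((B powr p) powr (1 / p))"
      unfolding b_def by (rule hardy_bound_half_line[OF p12(1) a B_ge_1])
    then have half: "hardy_bound half_line_funs p a B"
      using B0 p by (simp add: powr_powr)
    have C: "hardy_bound half_line_funs p a (C_const p a)" "C_const p a \<le> B"
      unfolding C_const_def using hardy_bound_Least[OF _ half] half p by auto
    have "B \<le> C_const p a"
      by (intro B_least hardy_bound_antimono[OF C(1)]) (auto simp: positive_funs_def)
    with C show ?thesis by simp
  qed

  have case3: "(\<exists>!\<beta>. 1 < \<beta> \<and> beta1_eq p a \<beta>) \<and> B powr p = k_fun p a 0 (beta1 p a)"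
    if p12: "1 < p" "p < 2" and a3: "a \<le> p - 2"
  proof -
    obtain \<beta> where \<beta>: "1 < \<beta>" "beta1_lhs p a \<beta> = 0"
      and pos: "\<And>x. 1 < x \<Longrightarrow> x < \<beta> \<Longrightarrow> 0 < beta1_lhs p a x"
      and neg: "\<And>x. \<beta> < x \<Longrightarrow> beta1_lhs p a x < 0"
      using beta1_root[OF p12 a3] by blast
    have uniq: "x = \<beta>" if "1 < x" "beta1_eq p a x" for x
      using pos[of x] neg[of x] that by (cases x \<beta> rule: linorder_cases) (auto simp: beta1_eq_iff)
    have root: "1 < \<beta> \<and> beta1_eq p a \<beta>"
      using \<beta> by (simp add: beta1_eq_iff)
    then have ex1: "\<exists>!\<beta>. 1 < \<beta> \<and> beta1_eq p a \<beta>"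
      using uniq by blast
    have \<beta>_eq: "beta1 p a = \<beta>"
      unfolding beta1_def by (rule the1_equality[OF ex1 root])
    \<comment> \<open>This makes \<open>0\<close> and \<open>\<beta>\<close> an admissible pair of
      exponents. Otherwise \<open>b\<close> would lie at or beyond the root, but there the affine
      part of \<open>beta1_lhs\<close> equals \<open>b\<close> and the rest is nonnegative.\<close>
    have \<beta>b: "b < \<beta>"
    proof (rule ccontr)
      assume "\<not> b < \<beta>"
      then have "\<beta> \<le> b" by simp
      then have "beta1_lhs p a b \<le> 0"
        using neg[of b] \<beta> by (cases "\<beta> = b") auto
      moreover have "0 < beta1_lhs p a b"
      proof -
        have "beta1_lhs p a b = p * b * (\<bar>1 - b\<bar> powr (p - 2) * (b - 1)) + b"
          unfolding beta1_lhs_def b(2)[symmetric] using b(2) by (simp add: algebra_simps)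
        moreover have "0 \<le> p * b * (\<bar>1 - b\<bar> powr (p - 2) * (b - 1))"
          using b p \<beta> \<open>\<beta> \<le> b\<close> by (intro mult_nonneg_nonneg) auto
        ultimately show ?thesis using b by simp
      qed
      ultimately show False by simp
    qed
    define M where "M = k_fun p a 0 \<beta>"
    have M_eq: "M = tangent_quotient p b \<beta>"
    proof -
      have "M = ((\<beta> - b) + b * (\<beta> - 1) powr p) / (b * \<beta> powr p)"
        using \<beta> p by (simp add: M_def k_fun_def flip: b_def)
      also have "\<dots> = ((\<beta> - 1) powr p + \<beta> / b - 1) / \<beta> powr p"
        using b \<beta> by (simp add: field_simps)
      finally show ?thesis using \<beta> by (simp add: tangent_quotient_def)
    qed
    have "0 \<le> \<bar>\<beta> - 1\<bar> powr p + (\<beta> / b - 1)"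
      using \<beta>b b by (intro add_nonneg_nonneg) auto
    then have "0 \<le> M"
      unfolding M_eq tangent_quotient_def by (intro divide_nonneg_nonneg) auto
    then have "B powr p \<le> M"
    proof (rule B_le[of _ "1 / b"])
      fix x :: real assume "0 \<le> x"
      show "\<bar>x - 1\<bar> powr p + 1 / b * (x - b) \<le> M * \<bar>x\<bar> powr p"
      proof (cases "x = 0")
        case False
        then have "0 < x" using \<open>0 \<le> x\<close> by simp
        have "tangent_quotient p b x \<le> M"
          unfolding M_eq b_def by (rule tangent_quotient_le[OF p12 a3 \<beta>(1) pos neg \<open>0 < x\<close>])
        then show ?thesis
          using \<open>0 < x\<close> b by (simp add: tangent_quotient_def divide_le_eq algebra_simps diff_divide_distrib)
      qed (use b in simp)
    qed
    moreover have "M \<le> B powr p"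
      unfolding M_def using b \<beta>b by (intro k_le_B) auto
    ultimately show ?thesis using ex1 by (simp add: \<beta>_eq M_def)
  qed

  have case4: "B powr p = (if -1 < a then max (A_const p a powr p) 1 else 1)" if p2: "2 \<le> p"
  proof (cases "-1 < a")
    case False
    \<comment> \<open>For \<open>1 \<le> b\<close> the line of slope \<open>1 / b\<close> is below
      \<open>x - 1\<close> on \<open>0 \<le> x\<close>, so \<open>M = 1\<close> suffices.\<close>
    have b1: "1 \<le> b" using False p by (simp add: b_def le_divide_eq)
    have "B powr p \<le> 1"
    proof (rule B_le[of _ "1 / b"])
      fix x :: real assume x: "0 \<le> x"
      have "1 / b * (x - b) \<le> x - 1"
        using b1 x mult_right_mono[OF b1 x] by (simp add: field_simps)
      moreover have "\<bar>x - 1\<bar> powr p + (x - 1) \<le> \<bar>x\<bar> powr p"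
      proof (cases "x \<le> 1")
        case True
        then have "\<bar>x - 1\<bar> powr p \<le> 1 - x" using powr_le_linear[of p "1 - x"] p x by simp
        then show ?thesis using powr_ge_zero[of "\<bar>x\<bar>" p] by linarith
      next
        case False
        have "x - 1 \<le> p * (x - 1)" using False p by simp
        moreover have "1 + p * (x - 1) + (x - 1) powr p \<le> x powr p"
          using one_plus_powr_ge[of p "x - 1"] p2 False by simp
        ultimately have "(x - 1) powr p + (x - 1) \<le> x powr p" by linarith
        then show ?thesis using False by simp
      qed
      ultimately show "\<bar>x - 1\<bar> powr p + 1 / b * (x - b) \<le> 1 * \<bar>x\<bar> powr p" by linarith
    qed simp
    then show ?thesis using False B_ge_1 by simp
  next
    case True
    have b1: "b < 1" using True p by (simp add: b_def divide_less_eq)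
    define A where "A = A_const p a"
    have dec: "positive_decreasing_funs \<subseteq> positive_funs" by (auto simp: positive_decreasing_funs_def)
    have A: "hardy_bound positive_decreasing_funs p a A" "A \<le> B"
      unfolding A_def A_const_def
      using hardy_bound_Least[OF _ hardy_bound_antimono[OF B dec]] hardy_bound_antimono[OF B dec] p by auto
    have A0: "0 \<le> A" using A by (simp add: hardy_bound_def)
    have AB: "A powr p \<le> B powr p" using A A0 p by (intro powr_mono2) auto
    define M where "M = max (A powr p) 1"
    have M: "1 \<le> M" "A powr p \<le> M" by (simp_all add: M_def)
    \<comment> \<open>On \<open>{0..1}\<close> the test functions are decreasing, so
      \<open>A\<close> controls \<open>k_fun\<close> there. The least slope is taken because the
      line has to be continued beyond 1.\<close>
    obtain c where c: "\<And>x. x \<in> {0..1} \<Longrightarrow> \<bar>x - 1\<bar> powr p + c * (x - b) \<le> M * \<bar>x\<bar> powr p"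
      and c_least: "\<And>u. (\<And>\<alpha>. \<alpha> \<in> {0..1} \<Longrightarrow> \<alpha> < b \<Longrightarrow>
        \<bar>\<alpha> - 1\<bar> powr p - M * \<bar>\<alpha>\<bar> powr p \<le> u * (b - \<alpha>)) \<Longrightarrow> c \<le> u"
    proof (rule supporting_slope[OF p a, of 0 "{0..1}" 1 M])
      show "k_fun p a \<alpha> \<beta> \<le> M"
        if "\<alpha> \<in> {0..1}" "\<beta> \<in> {0..1}" "\<alpha> < (p - 1 - a) / p" "(p - 1 - a) / p < \<beta>" for \<alpha> \<beta>
        using k_fun_le_hardy_bound[OF p a that(3,4) two_powers_positive_decreasing_funs A(1)] that M(2)
        by auto
    qed (use b b1 in \<open>auto simp: b_def\<close>)
    have c1: "c * (1 - b) \<le> M" using c[of 1] by simp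
    \<comment> \<open>If \<open>1 \<le> p * (1 - b)\<close>, the estimate \<open>c1\<close> at
      \<open>x = 1\<close> suffices. Otherwise \<open>p - 1 \<le> p * b\<close> shows that slope
      \<open>p * M\<close> works left of \<open>b\<close>, and minimality of \<open>c\<close>
      applies.\<close>
    have c_le: "c \<le> p * M"
    proof (cases "b \<le> 1 - 1 / p")
      case True
      then have "1 \<le> p * (1 - b)" using p by (simp add: field_simps)
      then have "1 * M \<le> p * (1 - b) * M" using M by (intro mult_right_mono) auto
      then have "c * (1 - b) \<le> (p * M) * (1 - b)" using c1 by (simp add: mult_ac)
      then show ?thesis using b1 by simp
    next
      case False
      then have pb: "p - 1 \<le> p * b" using p by (simp add: field_simps)
      show ?thesis
      proof (rule c_least)
        fix \<alpha> assume \<alpha>: "\<alpha> \<in> {0..1::real}" "\<alpha> < b"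
        have "(1 - \<alpha>) powr p - \<alpha> powr p \<le> p * (1 - \<alpha>) - 1"
          using powr_minus_reflected_powr_le[of p "1 - \<alpha>"] p2 \<alpha> by simp
        also have "\<dots> \<le> p * (b - \<alpha>)" using pb by (simp add: algebra_simps)
        also have "\<dots> \<le> p * M * (b - \<alpha>)" using M p \<alpha> by (intro mult_right_mono) auto
        finally have "(1 - \<alpha>) powr p - \<alpha> powr p \<le> p * M * (b - \<alpha>)" .
        moreover have "\<alpha> powr p \<le> M * \<alpha> powr p"
          using mult_right_mono[OF M(1), of "\<alpha> powr p"] by simp
        ultimately show "\<bar>\<alpha> - 1\<bar> powr p - M * \<bar>\<alpha>\<bar> powr p \<le> p * M * (b - \<alpha>)"
          using \<alpha> by simp
      qed
    qed
    have "B powr p \<le> M"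
    proof (rule B_le[of _ c])
      fix x :: real assume x: "0 \<le> x"
      show "\<bar>x - 1\<bar> powr p + c * (x - b) \<le> M * \<bar>x\<bar> powr p"
      proof (cases "x \<le> 1")
        case True
        then show ?thesis using c x by simp
      next
        case False
        \<comment> \<open>Beyond 1 the line gains at most \<open>p * M * y\<close> on its value at
          1, which the expansion of \<open>M * (1 + y) powr p\<close> absorbs.\<close>
        define y where "y = x - 1"
        have y: "0 < y" "x = 1 + y" using False by (auto simp: y_def)
        have "y powr p \<le> M * y powr p"
          using mult_right_mono[OF M(1), of "y powr p"] by simp
        moreover have "M * (1 + p * y + y powr p) \<le> M * (1 + y) powr p"
          using one_plus_powr_ge[of p y] p2 y M by (intro mult_left_mono) auto
        moreover have "c * y \<le> p * M * y" using c_le y by (intro mult_right_mono) auto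
        moreover have "M * (1 + p * y + y powr p) = M + p * M * y + M * y powr p"
          "c * (x - b) = c * (1 - b) + c * y"
          using y by (simp_all add: algebra_simps)
        moreover have abs: "\<bar>x - 1\<bar> = y" "\<bar>x\<bar> = 1 + y" using y by auto
        ultimately show ?thesis unfolding abs using c1 by linarith
      qed
    qed (use M in simp)
    moreover have "M \<le> B powr p" using AB B_ge_1 by (simp add: M_def)
    ultimately have "B powr p = M" by (rule antisym)
    then show ?thesis using True by (simp add: M_def A_def)
  qed

  show ?thesis
    using case1 case2 case3 case4 by (simp add: B_def)
qed

end
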